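(* Let $\mathcal{X}\subseteq\mathbb{R}^d$ be compact, let $p\colon\mathcal{X}\to(0,\infty)$ be a strictly positive continuous probability density w.r.t. Lebesgue measure with induced distribution $\pi$, and let $\widetilde{\pi}$ be a probability distribution on $\mathcal{X}$ with density $\widetilde{p}$. Let $\mathcal{Z}=\{z_u:u\in\mathcal{U}\}$, $\mathcal{U}\subseteq\mathbb{R}^s$, be a parametrized set of $C^1$-diffeomorphisms $z_u\colon\mathcal{X}\to\mathcal{X}$. Assume that (i) $\widetilde{p}\colon\mathcal{X}\to(0,\infty)$ is strictly positive and continuous; (ii) the map $(u,x)\mapsto z_u(x)$ is continuous; (iii) there exists $\lambda>0$ such that $|\det D_x(z_u)^{-1}(x_0)|>\lambda$ for all $u\in\mathcal{U}$ and $x_0\in\mathcal{X}$. Let $(X_n,Z_n)_{n\in\mathbb{N}_0}$ be the process generated by the AIR independent Metropolis–Hastings algorithm with normalizing flows (described in the context). Then there exists $\widetilde{C}\in(0,\infty)$ such that for every bounded measurable $h\colon\mathcal{X}\to\mathbb{R}$ and every $n\in\mathbb{N}$, \[ \mathbb{E}\left[\left|\widehat{\pi}_n(h)-\pi(h)\right|^2\right]\le\frac{\widetilde{C}\,\|h\|_\infty^2}{n}. \]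
   Context: Notation: $\widehat{\pi}_n(h)=\frac1n\sum_{j=1}^nh(X_j)$, $\pi(h)=\int h\,d\pi$, $\|h\|_\infty=\sup_{x\in\mathcal{X}}|h(x)|$. For a flow $z\in\mathcal{Z}$, $p_z(x)=\widetilde{p}(z^{-1}(x))\,|\det Dz^{-1}(x)|$ denotes the density of $z(\widetilde{X})$ for $\widetilde{X}\sim\widetilde{\pi}$. For $y_1,\dots,y_n\in\mathcal{X}$, $J_z^{(n)}(y_1,\dots,y_n)=-\frac1n\sum_{j=1}^n\log p_z(y_j)$. Algorithm (AIR independent Metropolis–Hastings with normalizing flows). It is a scheme with initial value $X_0$ drawn from some initial distribution on $\mathcal{X}$ and $Z_0$ drawn from some transition kernel $Q_0(X_0,\cdot)$ from $\mathcal{X}$ to $\mathcal{Z}$, and with $X_1$ obtained from $(X_0,Z_0)$ by steps 2 and 3 below with $n=0$. For $n\in\mathbb{N}$, given $(X_0,\dots,X_n)=(x_0,\dots,x_n)$ and $(Z_0,\dots,Z_{n-1})=(z_0,\dots,z_{n-1})$: 1. If $n=j(j+1)/2$ for some $j\in\mathbb{N}$, then $z_n\in\mathcal{Z}$ is (approximately) computed as a minimizer over $z\in\mathcal{Z}$ of $J_z^{(n)}(x_1,\dots,x_n)$ (the minimum is assumed to exist; formally $Z_n$ is drawn from a transition kernel from $\mathcal{X}^{n+1}\times\mathcal{Z}^n$ to $\mathcal{Z}$, which represents the possibly inexact minimization, with no requirement on its accuracy). Otherwise $z_n=z_{n-1}$. 2. Sample $\widetilde{X}\sim\widetilde{\pi}$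 independently of everything else, with realization $\widetilde{x}$, and put $y=z_n(\widetilde{x})$. 3. Set $x_{n+1}=y$ with probability $a_{z_n}(x_n,y)=\min\left\{1,\frac{p(y)\,p_{z_n}(x_n)}{p(x_n)\,p_{z_n}(y)}\right\}$, else set $x_{n+1}=x_n$. $\mathcal{Z}$ is equipped with a $\sigma$-algebra for which the transition mechanism $(z,x)\mapsto x_{n+1}$ of steps 2 and 3 is a transition kernel from $\mathcal{Z}\times\mathcal{X}$ to $\mathcal{X}$. *)

theory Defs
  imports "HOL-Probability.Probability"
begin

definition density_on :: "(real ^ 'd) set \<Rightarrow> (real ^ 'd \<Rightarrow> real) \<Rightarrow> (real ^ 'd) measure" where
  "density_on \<X> f = density (restrict_space lborel \<X>) (\<lambda>x. ennreal (f x))"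

text \<open>Derivatives on the compact set \<open>\<X>\<close> are taken within \<open>\<X>\<close>, so boundary points are included.
  Where \<open>\<X>\<close> is too thin for such a derivative to be unique, the Jacobian field is part of the data:
  below, \<open>D\<close> and \<open>J\<close> may be any continuous fields of derivatives.\<close>

definition C1_derivative_on ::
  "(real ^ 'd) set \<Rightarrow> (real ^ 'd \<Rightarrow> real ^ 'd) \<Rightarrow> (real ^ 'd \<Rightarrow> real ^ 'd ^ 'd) \<Rightarrow> bool" where
  "C1_derivative_on \<X> f D \<longleftrightarrow>
     (\<forall>x\<in>\<X>. (f has_derivative (\<lambda>v. D x *v v)) (at x within \<X>)) \<and> continuous_on \<X> D"

text \<open>\<open>z\<close> is a \<open>C\<^sup>1\<close>-diffeomorphism of \<open>\<X>\<close> onto itself whose inverse has Jacobian field \<open>J\<close>.\<close>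

definition C1_diffeo_on ::
  "(real ^ 'd) set \<Rightarrow> (real ^ 'd \<Rightarrow> real ^ 'd) \<Rightarrow> (real ^ 'd \<Rightarrow> real ^ 'd ^ 'd) \<Rightarrow> bool" where
  "C1_diffeo_on \<X> z J \<longleftrightarrow>
     bij_betw z \<X> \<X> \<and> (\<exists>D. C1_derivative_on \<X> z D) \<and>
     C1_derivative_on \<X> (the_inv_into \<X> z) J"

text \<open>In the following, \<open>pt\<close> is the reference density \<open>p\<close>-tilde and \<open>Dinv z\<close> is the Jacobian field of
  the inverse of the flow \<open>z\<close>.\<close>

definition flow_density ::
  "(real ^ 'd) set \<Rightarrow> (real ^ 'd \<Rightarrow> real) \<Rightarrow>
   ((real ^ 'd \<Rightarrow> real ^ 'd) \<Rightarrow> real ^ 'd \<Rightarrow> real ^ 'd ^ 'd) \<Rightarrow>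
   (real ^ 'd \<Rightarrow> real ^ 'd) \<Rightarrow> real ^ 'd \<Rightarrow> real" where
  "flow_density \<X> pt Dinv z x = pt (the_inv_into \<X> z x) * \<bar>det (Dinv z x)\<bar>"

definition flow_objective ::
  "(real ^ 'd) set \<Rightarrow> (real ^ 'd \<Rightarrow> real) \<Rightarrow>
   ((real ^ 'd \<Rightarrow> real ^ 'd) \<Rightarrow> real ^ 'd \<Rightarrow> real ^ 'd ^ 'd) \<Rightarrow>
   nat \<Rightarrow> (nat \<Rightarrow> real ^ 'd) \<Rightarrow> (real ^ 'd \<Rightarrow> real ^ 'd) \<Rightarrow> real" where
  "flow_objective \<X> pt Dinv n y z =
     - (1 / real n) * (\<Sum>j=1..n. ln (flow_density \<X> pt Dinv z (y j)))"

definition acceptance_prob ::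
  "(real ^ 'd) set \<Rightarrow> (real ^ 'd \<Rightarrow> real) \<Rightarrow> (real ^ 'd \<Rightarrow> real) \<Rightarrow>
   ((real ^ 'd \<Rightarrow> real ^ 'd) \<Rightarrow> real ^ 'd \<Rightarrow> real ^ 'd ^ 'd) \<Rightarrow>
   (real ^ 'd \<Rightarrow> real ^ 'd) \<Rightarrow> real ^ 'd \<Rightarrow> real ^ 'd \<Rightarrow> real" where
  "acceptance_prob \<X> p pt Dinv z x y =
     min 1 ((p y * flow_density \<X> pt Dinv z x) / (p x * flow_density \<X> pt Dinv z y))"

definition imh_kernel ::
  "(real ^ 'd) set \<Rightarrow> (real ^ 'd \<Rightarrow> real) \<Rightarrow> (real ^ 'd \<Rightarrow> real) \<Rightarrow>
   ((real ^ 'd \<Rightarrow> real ^ 'd) \<Rightarrow> real ^ 'd \<Rightarrow> real ^ 'd ^ 'd) \<Rightarrow>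
   (real ^ 'd \<Rightarrow> real ^ 'd) \<Rightarrow> real ^ 'd \<Rightarrow> (real ^ 'd) measure" where
  "imh_kernel \<X> p pt Dinv z x =
     bind (density_on \<X> pt) (\<lambda>xt.
     bind (measure_pmf (bernoulli_pmf (acceptance_prob \<X> p pt Dinv z x (z xt)))) (\<lambda>accept.
     return (restrict_space borel \<X>) (if accept then z xt else x)))"

text \<open>Given \<open>H\<close>, the random variable \<open>Y\<close> is drawn from the transition kernel \<open>K\<close>, i.e. \<open>K\<close> is a
  regular version of the conditional distribution of \<open>Y\<close> given \<open>H\<close>.\<close>

definition drawn_from ::
  "'w measure \<Rightarrow> 'h measure \<Rightarrow> 'y measure \<Rightarrow> ('w \<Rightarrow> 'h) \<Rightarrow> ('w \<Rightarrow> 'y) \<Rightarrow> ('h \<Rightarrow> 'y measure) \<Rightarrow> bool" where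
  "drawn_from M MH MY H Y K \<longleftrightarrow>
     H \<in> M \<rightarrow>\<^sub>M MH \<and> Y \<in> M \<rightarrow>\<^sub>M MY \<and> K \<in> MH \<rightarrow>\<^sub>M prob_algebra MY \<and>
     (\<forall>A\<in>sets MH. \<forall>B\<in>sets MY.
        emeasure M {\<omega> \<in> space M. H \<omega> \<in> A \<and> Y \<omega> \<in> B} =
        (\<integral>\<^sup>+ \<omega>. indicator A (H \<omega>) * emeasure (K (H \<omega>)) B \<partial>M))"

definition adaptation_time :: "nat \<Rightarrow> bool" where
  "adaptation_time n \<longleftrightarrow> (\<exists>j\<ge>1. n = j * (j + 1) div 2)"

text \<open>\<open>MZ\<close> is the set of flows with its sigma-algebra.  The (possibly inexact) minimization at an
  adaptation time \<open>n\<close> is the kernel \<open>Q n\<close>, applied to \<open>((X\<^sub>0, \<dots>, X\<^sub>n), (Z\<^sub>0, \<dots>, Z\<^sub>n\<^sub>-\<^sub>1))\<close>.  The initial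
  distribution is the law of \<open>X 0\<close>.\<close>

definition air_imh_process ::
  "(real ^ 'd) set \<Rightarrow> (real ^ 'd \<Rightarrow> real) \<Rightarrow> (real ^ 'd \<Rightarrow> real) \<Rightarrow>
   ((real ^ 'd \<Rightarrow> real ^ 'd) \<Rightarrow> real ^ 'd \<Rightarrow> real ^ 'd ^ 'd) \<Rightarrow>
   (real ^ 'd \<Rightarrow> real ^ 'd) measure \<Rightarrow>
   (real ^ 'd \<Rightarrow> (real ^ 'd \<Rightarrow> real ^ 'd) measure) \<Rightarrow>
   (nat \<Rightarrow> (nat \<Rightarrow> real ^ 'd) \<times> (nat \<Rightarrow> real ^ 'd \<Rightarrow> real ^ 'd) \<Rightarrow> (real ^ 'd \<Rightarrow> real ^ 'd) measure) \<Rightarrow>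
   'w measure \<Rightarrow> (nat \<Rightarrow> 'w \<Rightarrow> real ^ 'd) \<Rightarrow> (nat \<Rightarrow> 'w \<Rightarrow> real ^ 'd \<Rightarrow> real ^ 'd) \<Rightarrow> bool" where
  "air_imh_process \<X> p pt Dinv MZ Q0 Q M X Z \<longleftrightarrow>
     (let MX = restrict_space borel \<X> in
      prob_space M \<and>
      (\<forall>n. X n \<in> M \<rightarrow>\<^sub>M MX) \<and> (\<forall>n. Z n \<in> M \<rightarrow>\<^sub>M MZ) \<and>
      drawn_from M MX MZ (X 0) (Z 0) Q0 \<and>
      (\<forall>n\<ge>1.
         if adaptation_time n
         then drawn_from M (PiM {..n} (\<lambda>_. MX) \<Otimes>\<^sub>M PiM {..<n} (\<lambda>_. MZ)) MZ
                (\<lambda>\<omega>. (\<lambda>i\<in>{..n}. X i \<omega>, \<lambda>i\<in>{..<n}. Z i \<omega>)) (Z n) (Q n)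
         else AE \<omega> in M. Z n \<omega> = Z (n - 1) \<omega>) \<and>
      (\<forall>n. drawn_from M (PiM {..n} (\<lambda>_. MX) \<Otimes>\<^sub>M PiM {..n} (\<lambda>_. MZ)) MX
             (\<lambda>\<omega>. (\<lambda>i\<in>{..n}. X i \<omega>, \<lambda>i\<in>{..n}. Z i \<omega>)) (X (Suc n))
             (\<lambda>(xs, zs). imh_kernel \<X> p pt Dinv (zs n) (xs n))))"

end

theory Submission imports Defs begin

text \<open>
  Every kernel \<open>P\<^sub>z\<close> of the algorithm is reversible with respect to \<open>\<pi>\<close> and dominates \<open>\<beta> \<pi>\<close>, where
  \<open>\<beta>\<close> depends only on \<open>inf pt\<close>, \<open>\<lambda>\<close> and \<open>sup p\<close>. Hence \<open>P\<^sub>z\<close> contracts centred functions in the supremum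
  norm by the factor \<open>1 - \<beta>\<close>, and the Poisson equation \<open>g\<^sub>z - P\<^sub>z g\<^sub>z = h - \<pi>(h)\<close> has the solution
  \<open>g\<^sub>z = \<Sum>\<^sub>k P\<^sub>z\<^sup>k (h - \<pi>(h))\<close>, bounded by \<open>2 \<parallel>h\<parallel> / \<beta>\<close> uniformly in \<open>z\<close>. Summing the equation at
  \<open>(X\<^sub>j, Z\<^sub>j)\<close> splits the error into a sum of bounded orthogonal martingale differences, of second moment
  \<open>O(n)\<close>, and a sum that telescopes between adaptation times. Only \<open>O(\<surd>n)\<close> of these occur up to
  time \<open>n\<close>, so the square of the second sum is \<open>O(n)\<close> as well.
\<close>

section \<open>Change of variables in arbitrary finite dimension\<close>

text \<open>The change-of-variables theorem of the library requires the index type of the vectors to be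
  well-ordered. An ordered copy of the index type removes this restriction.\<close>

typedef 'a ordered_copy = "UNIV :: 'a set" morphisms of_copy to_copy ..

lemma to_copy_inverse' [simp]: "of_copy (to_copy x) = x"
  by (simp add: to_copy_inverse)

declare of_copy_inverse [simp]

lemma bij_to_copy: "bij to_copy"
  by (metis bijI' of_copy_inverse to_copy_inverse')

lemma bij_of_copy: "bij of_copy"
  by (metis bijI' of_copy_inverse to_copy_inverse')

instance ordered_copy :: (finite) finite
proof
  have "(UNIV :: 'a ordered_copy set) = range to_copy"
    using bij_to_copy by (metis bij_is_surj)
  then show "finite (UNIV :: 'a ordered_copy set)"
    by (metis finite_imageI finite_class.finite_UNIV)
qed

instantiation ordered_copy :: (finite) wellorder
begin

definition less_eq_ordered_copy :: "'a ordered_copy \<Rightarrow> 'a ordered_copy \<Rightarrow> bool" where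
  "x \<le> y \<longleftrightarrow> to_nat_on UNIV (of_copy x) \<le> to_nat_on UNIV (of_copy y)"

definition less_ordered_copy :: "'a ordered_copy \<Rightarrow> 'a ordered_copy \<Rightarrow> bool" where
  "x < y \<longleftrightarrow> to_nat_on UNIV (of_copy x) < to_nat_on UNIV (of_copy y)"

instance
proof
  fix x y :: "'a ordered_copy"
  assume "x \<le> y" "y \<le> x"
  \<comment> \<open>\<open>to_nat_on\<close> is injective on countable sets, in particular on the
    universe of a finite type.\<close>
  then have "of_copy x = of_copy y"
    by (simp add: less_eq_ordered_copy_def uncountable_infinite)
  then show "x = y"
    by (simp add: of_copy_inject)
next
  fix P :: "'a ordered_copy \<Rightarrow> bool" and a
  assume step: "\<And>x. (\<And>y. y < x \<Longrightarrow> P y) \<Longrightarrow> P x"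
  show "P a"
  proof (induction a rule: measure_induct_rule[of "\<lambda>x. to_nat_on UNIV (of_copy x)"])
    case (less x)
    then show ?case
      using step[of x] by (simp add: less_ordered_copy_def)
  qed
qed (auto simp: less_eq_ordered_copy_def less_ordered_copy_def)

end

section \<open>Relabelling of coordinates, determinants and volumes\<close>

definition vec_copy :: "real ^ 'n \<Rightarrow> real ^ 'n ordered_copy" where
  "vec_copy v = (\<chi> i. v $ of_copy i)"

definition vec_uncopy :: "real ^ 'n ordered_copy \<Rightarrow> real ^ 'n" where
  "vec_uncopy v = (\<chi> i. v $ to_copy i)"

lemma vec_copy_inverse [simp]: "vec_uncopy (vec_copy v) = v" "vec_copy (vec_uncopy w) = w"
  by (simp_all add: vec_copy_def vec_uncopy_def vec_eq_iff)

lemma bounded_linear_vec_copy: "bounded_linear vec_copy" "bounded_linear vec_uncopy"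
  by (auto intro!: linear_linear[THEN iffD2] linearI simp: linear_conv_bounded_linear[symmetric]
      vec_copy_def vec_uncopy_def vec_eq_iff)

lemma vec_copy_measurable [measurable]:
  "vec_copy \<in> borel_measurable borel" "vec_uncopy \<in> borel_measurable borel"
  using bounded_linear_vec_copy
  by (auto intro!: borel_measurable_continuous_onI linear_continuous_on)

text \<open>Conjugation by \<open>to_copy\<close> is a bijection between the permutations of the two
  index types. It preserves the sign and the product in each term of the Leibniz formula.\<close>

lemma det_ordered_copy:
  fixes A :: "real ^ 'n ^ 'n"
  shows "det (\<chi> i j. A $ of_copy i $ of_copy j :: real ^ 'n ordered_copy ^ 'n ordered_copy) = det A"
proof -
  let ?c = "to_copy :: 'n \<Rightarrow> 'n ordered_copy"
  let ?m = "map_permutation UNIV ?c"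
  have m: "?m p = (\<lambda>x. to_copy (p (of_copy x)))" if "p permutes UNIV" for p
    using map_permutation_apply[of ?c UNIV _ p] bij_to_copy that
    by (metis (no_types, lifting) UNIV_I bij_def ext of_copy_inverse)
  have bij: "bij_betw ?m {p. p permutes UNIV} {p. p permutes UNIV}"
  proof (rule bij_betw_cong[THEN iffD1, OF _ bij_betw_permutations[OF bij_to_copy]])
    fix p :: "'n \<Rightarrow> 'n" assume "p \<in> {p. p permutes UNIV}"
    then show "(\<lambda>x. if x \<in> UNIV then to_copy (p (inv to_copy x)) else x) = ?m p"
      by (simp add: m fun_eq_iff) (metis bij_inv_eq_iff bij_to_copy of_copy_inverse)
  qed
  have "(\<Sum>p | p permutes UNIV. of_int (sign p) * (\<Prod>i\<in>UNIV. A $ of_copy i $ of_copy (p i)))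
      = (\<Sum>p | p permutes UNIV. of_int (sign (?m p)) * (\<Prod>i\<in>UNIV. A $ of_copy i $ of_copy (?m p i)))"
    by (rule sum.reindex_bij_betw[OF bij, symmetric])
  also have "\<dots> = (\<Sum>p | p permutes UNIV. of_int (sign p) * (\<Prod>i\<in>UNIV. A $ i $ p i))"
  proof (rule sum.cong, simp, clarify)
    fix p :: "'n \<Rightarrow> 'n" assume p: "p permutes UNIV"
    have "sign (?m p) = sign p"
      using p bij_to_copy by (intro sign_map_permutation) (auto simp: bij_def)
    moreover have "(\<Prod>i\<in>UNIV. A $ of_copy i $ of_copy (?m p i)) = (\<Prod>i\<in>UNIV. A $ i $ p i)"
      unfolding m[OF p] using prod.reindex_bij_betw[OF bij_of_copy, of "\<lambda>i. A $ i $ p i"]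
      by simp
    ultimately show "of_int (sign (?m p)) * (\<Prod>i\<in>UNIV. A $ of_copy i $ of_copy (?m p i))
        = of_int (sign p) * (\<Prod>i\<in>UNIV. A $ i $ p i)"
      by simp
  qed
  finally show ?thesis
    by (simp add: det_def)
qed

lemma Basis_vec_real: "(Basis :: (real ^ 'n) set) = range (\<lambda>i. axis i 1)"
  by (auto simp: Basis_vec_def)

text \<open>\<open>lborel\<close> is determined by the volumes of boxes, and relabelling the
  coordinates merely reorders the side lengths.\<close>

lemma lborel_vec_copy: "distr lborel borel vec_copy = (lborel :: (real ^ 'n::finite ordered_copy) measure)"
proof (rule lborel_eqI[symmetric])
  fix l u :: "real ^ 'n ordered_copy"
  assume lu: "\<And>b. b \<in> Basis \<Longrightarrow> l \<bullet> b \<le> u \<bullet> b"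
  have le: "l $ i \<le> u $ i" for i
    using lu[of "axis i 1"] by (auto simp: Basis_vec_real inner_axis)
  have prods: "(\<Prod>b\<in>Basis. w \<bullet> b) = (\<Prod>i\<in>UNIV. w $ i)" for w :: "real ^ 'm"
    unfolding Basis_vec_real
    by (subst prod.reindex) (auto simp: inj_on_def axis_eq_axis inner_axis)
  have "vec_copy -` box l u = box (vec_uncopy l) (vec_uncopy u)"
    unfolding set_eq_iff mem_box_cart vimage_eq vec_copy_def vec_uncopy_def
    by simp (metis of_copy_inverse to_copy_inverse')
  then have "emeasure (distr lborel borel vec_copy) (box l u)
      = emeasure lborel (box (vec_uncopy l) (vec_uncopy u))"
    by (subst emeasure_distr) auto
  also have "\<dots> = ennreal (\<Prod>b\<in>Basis. (vec_uncopy u - vec_uncopy l) \<bullet> b)"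
    by (rule emeasure_lborel_box) (auto simp: Basis_vec_real inner_axis vec_uncopy_def le)
  also have "(\<Prod>b\<in>Basis. (vec_uncopy u - vec_uncopy l) \<bullet> b) = (\<Prod>b\<in>Basis. (u - l) \<bullet> b)"
    unfolding prods
    using prod.reindex_bij_betw[OF bij_to_copy, of "\<lambda>i. (u - l) $ i"]
    by (simp add: vec_uncopy_def)
  finally show "emeasure (distr lborel borel vec_copy) (box l u) = ennreal (\<Prod>b\<in>Basis. (u - l) \<bullet> b)" .
qed simp

text \<open>Derivatives within \<open>S\<close> suffice, which matters for compact sets with
  boundary. Finite volume of the image lets the gauge integral be read as an
  \<open>nn_integral\<close>.\<close>

lemma emeasure_differentiable_image_wellorder:
  fixes g :: "real ^ 'n::{finite,wellorder} \<Rightarrow> real ^ 'n::_"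
  assumes S: "S \<in> sets borel" and der: "\<And>x. x \<in> S \<Longrightarrow> (g has_derivative (\<lambda>v. G x *v v)) (at x within S)"
    and inj: "inj_on g S" and gS: "g ` S \<in> sets borel" "emeasure lborel (g ` S) < \<infinity>"
  shows "emeasure lborel (g ` S) = (\<integral>\<^sup>+x. ennreal \<bar>det (G x)\<bar> * indicator S x \<partial>lborel)"
proof -
  have lm: "g ` S \<in> lmeasurable"
    using gS by (simp add: fmeasurable_def)
  have "((\<lambda>x. \<bar>det (G x)\<bar>) has_integral measure lebesgue (g ` S)) S"
    using has_measure_differentiable_image[OF _ der inj, of "measure lebesgue (g ` S)"] S lm by simp
  then have "(\<integral>\<^sup>+x. ennreal \<bar>det (G x)\<bar> * indicator S x \<partial>lborel) = ennreal (measure lebesgue (g ` S))"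
    by (intro nn_integral_has_integral_lebesgue') auto
  also have "\<dots> = emeasure lborel (g ` S)"
    using gS emeasure_eq_measure2[OF lm] by simp
  finally show ?thesis ..
qed

text \<open>The map is conjugated with the relabelling and the ordered version is applied;
  determinant and volume are both unaffected. Assumption \<open>G\<close> serves to carry the
  integral back along \<open>vec_copy\<close>.\<close>

lemma emeasure_differentiable_image:
  fixes g :: "real ^ 'n \<Rightarrow> real ^ 'n"
  assumes S: "S \<in> sets borel" and der: "\<And>x. x \<in> S \<Longrightarrow> (g has_derivative (\<lambda>v. G x *v v)) (at x within S)"
    and inj: "inj_on g S" and gS: "g ` S \<in> sets borel" "emeasure lborel (g ` S) < \<infinity>"
    and G: "(\<lambda>x. ennreal \<bar>det (G x)\<bar> * indicator S x) \<in> borel_measurable borel"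
  shows "emeasure lborel (g ` S) = (\<integral>\<^sup>+x. ennreal \<bar>det (G x)\<bar> * indicator S x \<partial>lborel)"
proof -
  define g' where "g' = vec_copy \<circ> g \<circ> vec_uncopy"
  define G' where "G' x = (\<chi> i j. G (vec_uncopy x) $ of_copy i $ of_copy j)" for x
  have img: "vec_copy ` T = vec_uncopy -` T" for T :: "(real ^ 'n) set"
    by (auto simp: image_iff) (metis vec_copy_inverse(2))
  \<comment> \<open>The conjugated derivative has the matrix \<open>G x\<close> with rows and
    columns relabelled, the form treated by \<open>det_ordered_copy\<close>.\<close>
  have Gv: "vec_copy (G x *v vec_uncopy v) = G' (vec_copy x) *v v" for x v
    unfolding G'_def vec_copy_inverse matrix_vector_mult_def vec_copy_def[of "vec_lambda _"] matrix_vector_mult_def vec_uncopy_def[of v]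
    using sum.reindex_bij_betw[OF bij_to_copy, of "\<lambda>j. G x $ of_copy _ $ of_copy j * v $ j"]
    by (simp add: vec_eq_iff)
  have gS': "g' ` (vec_copy ` S) = vec_copy ` (g ` S)"
    by (simp add: g'_def image_comp o_def)
  have em: "emeasure lborel (vec_copy ` T) = emeasure lborel T" if "T \<in> sets borel" for T :: "(real ^ 'n) set"
  proof -
    have "emeasure lborel (vec_copy ` T) = emeasure (distr lborel borel vec_copy) (vec_copy ` T)"
      by (simp add: lborel_vec_copy)
    also have "\<dots> = emeasure lborel (vec_copy -` (vec_copy ` T))"
      unfolding img using that by (subst emeasure_distr) (auto intro: measurable_sets_borel[OF vec_copy_measurable(2)])
    also have "vec_copy -` (vec_copy ` T) = T"
      by (auto simp: img)
    finally show ?thesis .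
  qed
  have sets': "vec_copy ` T \<in> sets borel" if "T \<in> sets borel" for T :: "(real ^ 'n) set"
    unfolding img using that by (auto intro: measurable_sets_borel[OF vec_copy_measurable(2)])
  have "emeasure lborel (g' ` (vec_copy ` S))
      = (\<integral>\<^sup>+x. ennreal \<bar>det (G' x)\<bar> * indicator (vec_copy ` S) x \<partial>lborel)"
  proof (rule emeasure_differentiable_image_wellorder)
    show "vec_copy ` S \<in> sets borel" "g' ` vec_copy ` S \<in> sets borel"
      unfolding gS' using S gS sets' by auto
    show "emeasure lborel (g' ` vec_copy ` S) < \<infinity>"
      unfolding gS' using gS em by auto
    show "inj_on g' (vec_copy ` S)"
      using inj by (auto simp: inj_on_def g'_def) (metis vec_copy_inverse(1))+
  next
    fix y assume "y \<in> vec_copy ` S"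
    then obtain x where x: "x \<in> S" "y = vec_copy x" by auto
    have "(g' has_derivative (\<lambda>v. vec_copy (G x *v vec_uncopy v))) (at y within vec_copy ` S)"
      unfolding g'_def o_def
    proof (rule bounded_linear.has_derivative[OF bounded_linear_vec_copy(1)])
      have "(vec_uncopy has_derivative vec_uncopy) (at y within vec_copy ` S)"
        by (rule bounded_linear_imp_has_derivative[OF bounded_linear_vec_copy(2)])
      moreover have "(g has_derivative (\<lambda>v. G x *v v)) (at (vec_uncopy y) within vec_uncopy ` vec_copy ` S)"
        using der[OF x(1)] x(2) by (simp add: image_comp o_def)
      ultimately show "((\<lambda>x. g (vec_uncopy x)) has_derivative (\<lambda>v. G x *v vec_uncopy v)) (at y within vec_copy ` S)"
        using diff_chain_within[of vec_uncopy vec_uncopy y "vec_copy ` S" g] by (simp add: o_def)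
    qed
    then show "(g' has_derivative (\<lambda>v. G' y *v v)) (at y within vec_copy ` S)"
      by (simp add: Gv x(2))
  qed
  also have "(\<integral>\<^sup>+x. ennreal \<bar>det (G' x)\<bar> * indicator (vec_copy ` S) x \<partial>lborel)
     = (\<integral>\<^sup>+x. ennreal \<bar>det (G (vec_uncopy x))\<bar> * indicator S (vec_uncopy x) \<partial>distr lborel borel vec_copy)"
    unfolding G'_def det_ordered_copy lborel_vec_copy
    by (intro nn_integral_cong) (auto simp: img indicator_def)
  also have "\<dots> = (\<integral>\<^sup>+x. ennreal \<bar>det (G x)\<bar> * indicator S x \<partial>lborel)"
    using measurable_compose[OF vec_copy_measurable(2) G]
    by (subst nn_integral_distr) auto
  finally show ?thesis
    unfolding gS' using em gS by simp
qed

section \<open>The independent Metropolis--Hastings kernel of a flow\<close>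

lemma continuous_on_det:
  fixes J :: "'a::topological_space \<Rightarrow> real ^ 'n ^ 'n"
  assumes "continuous_on S J"
  shows "continuous_on S (\<lambda>x. det (J x))"
  unfolding det_def using assms by (intro continuous_intros)

text \<open>A single flow is fixed. The minorization derived below depends on it only through
  \<open>l\<close>, so that one constant serves all flows.\<close>

locale imh_flow =
  fixes \<X> :: "(real ^ 'd) set" and p pt :: "real ^ 'd \<Rightarrow> real"
    and Dinv :: "(real ^ 'd \<Rightarrow> real ^ 'd) \<Rightarrow> real ^ 'd \<Rightarrow> real ^ 'd ^ 'd"
    and \<zeta> :: "real ^ 'd \<Rightarrow> real ^ 'd" and l :: real
  assumes compact: "compact \<X>"
    and p_pos: "\<And>x. x \<in> \<X> \<Longrightarrow> p x > 0" and p_cont: "continuous_on \<X> p"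
    and pt_pos: "\<And>x. x \<in> \<X> \<Longrightarrow> pt x > 0" and pt_cont: "continuous_on \<X> pt"
    and pt_prob: "prob_space (density_on \<X> pt)"
    and diffeo: "C1_diffeo_on \<X> \<zeta> (Dinv \<zeta>)"
    and l: "l > 0" "\<And>x. x \<in> \<X> \<Longrightarrow> \<bar>det (Dinv \<zeta> x)\<bar> > l"
begin

abbreviation "L \<equiv> restrict_space lborel \<X>"
abbreviation "q \<equiv> flow_density \<X> pt Dinv \<zeta>"
abbreviation "w \<equiv> the_inv_into \<X> \<zeta>"
abbreviation "a \<equiv> acceptance_prob \<X> p pt Dinv \<zeta>"

section \<open>Regularity of the flow and its inverse\<close>

lemma \<X>_borel [measurable]: "\<X> \<in> sets borel"
  using compact by (simp add: borel_compact)

lemma space_L: "space L = \<X>"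
  by (simp add: space_restrict_space)

lemma sets_L: "sets L = sets (restrict_space borel \<X>)"
  by (rule sets_restrict_space_cong) simp

lemma continuous_measurable_L: "continuous_on \<X> f \<Longrightarrow> f \<in> borel_measurable L"
  for f :: "real ^ 'd \<Rightarrow> 'b::topological_space"
  using borel_measurable_continuous_on_restrict[of \<X> f] measurable_cong_sets[OF sets_L refl, of borel]
  by simp

lemma bij: "bij_betw \<zeta> \<X> \<X>" and inj: "inj_on \<zeta> \<X>" and \<zeta>_image: "\<zeta> ` \<X> = \<X>"
  using diffeo by (auto simp: C1_diffeo_on_def bij_betw_def)

lemma bij_w: "bij_betw w \<X> \<X>"
  by (rule bij_betw_the_inv_into[OF bij])

lemma w_\<zeta>: "x \<in> \<X> \<Longrightarrow> w (\<zeta> x) = x" and \<zeta>_w: "x \<in> \<X> \<Longrightarrow> \<zeta> (w x) = x"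
  using inj \<zeta>_image by (auto simp: the_inv_into_f_f f_the_inv_into_f)

lemma w_in: "x \<in> \<X> \<Longrightarrow> w x \<in> \<X>" and \<zeta>_in: "x \<in> \<X> \<Longrightarrow> \<zeta> x \<in> \<X>"
  using bij_w bij by (auto simp: bij_betw_def)

lemma w_derivative: "x \<in> \<X> \<Longrightarrow> (w has_derivative (\<lambda>v. Dinv \<zeta> x *v v)) (at x within \<X>)"
  and Dinv_cont: "continuous_on \<X> (Dinv \<zeta>)"
  using diffeo by (auto simp: C1_diffeo_on_def C1_derivative_on_def)

lemma w_cont: "continuous_on \<X> w"
  by (rule has_derivative_continuous_on[OF w_derivative])

lemma \<zeta>_cont: "continuous_on \<X> \<zeta>"
proof -
  obtain D where "\<And>x. x \<in> \<X> \<Longrightarrow> (\<zeta> has_derivative (\<lambda>v. D x *v v)) (at x within \<X>)"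
    using diffeo by (auto simp: C1_diffeo_on_def C1_derivative_on_def)
  then show ?thesis
    by (rule has_derivative_continuous_on)
qed

lemma q_cont: "continuous_on \<X> q"
  unfolding flow_density_def
  by (intro continuous_intros continuous_on_det Dinv_cont continuous_on_compose2[OF pt_cont w_cont])
    (auto intro: w_in)

lemma q_pos: "x \<in> \<X> \<Longrightarrow> q x > 0"
  unfolding flow_density_def using pt_pos[OF w_in] l by (intro mult_pos_pos) force+

lemma measurable_L [measurable]:
  "p \<in> borel_measurable L" "pt \<in> borel_measurable L" "q \<in> borel_measurable L"
  "(\<lambda>x. det (Dinv \<zeta> x)) \<in> borel_measurable L"
  by (auto intro!: continuous_measurable_L continuous_on_det p_cont pt_cont q_cont Dinv_cont)

lemma maps_measurable [measurable]: "\<zeta> \<in> L \<rightarrow>\<^sub>M L" "w \<in> L \<rightarrow>\<^sub>M L"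
  using continuous_measurable_L[OF \<zeta>_cont] continuous_measurable_L[OF w_cont]
  by (auto intro!: measurable_restrict_space2 simp: space_L w_in \<zeta>_in)

section \<open>Change of variables along the flow\<close>

lemma space_density_on [simp]: "space (density_on \<X> f) = \<X>"
  and sets_density_on [simp, measurable_cong]: "sets (density_on \<X> f) = sets L"
  by (auto simp: density_on_def space_restrict_space)

text \<open>A set \<open>A\<close> is the image under \<open>w\<close> of its own preimage, so its
  volume is the integral of the Jacobian of \<open>w\<close> over that preimage. Working with
  \<open>w\<close> rather than \<open>\<zeta>\<close> is natural because \<open>Dinv\<close> is the
  Jacobian field of the inverse.\<close>

lemma distr_inverse_flow:
  "distr (density_on \<X> (\<lambda>x. \<bar>det (Dinv \<zeta> x)\<bar>)) L w = L"
proof (rule measure_eqI)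
  fix A assume "A \<in> sets (distr (density_on \<X> (\<lambda>x. \<bar>det (Dinv \<zeta> x)\<bar>)) L w)"
  then have A [measurable]: "A \<in> sets L" by simp
  then have A\<X>: "A \<subseteq> \<X>" and A_borel: "A \<in> sets borel"
    using sets.sets_into_space[OF A] by (auto simp: space_L sets_restrict_space)
  define T where "T = w -` A \<inter> \<X>"
  have T: "T \<in> sets L"
    using measurable_sets[OF maps_measurable(2) A] by (simp add: T_def space_L)
  then have T_borel: "T \<in> sets borel" and T\<X>: "T \<subseteq> \<X>"
    by (auto simp: sets_restrict_space)
  \<comment> \<open>Each point \<open>y\<close> of \<open>A\<close> equals
    \<open>w (\<zeta> y)\<close>.\<close>
  have wT: "w ` T = A"
    using A\<X> \<zeta>_in w_\<zeta> by (force simp: T_def image_iff)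
  have "emeasure lborel (w ` T) = (\<integral>\<^sup>+x. ennreal \<bar>det (Dinv \<zeta> x)\<bar> * indicator T x \<partial>lborel)"
  proof (rule emeasure_differentiable_image[OF T_borel])
    show "(w has_derivative (\<lambda>v. Dinv \<zeta> x *v v)) (at x within T)" if "x \<in> T" for x
      using w_derivative T\<X> that by (blast intro: has_derivative_subset)
    show "inj_on w T"
      using bij_w T\<X> by (auto simp: bij_betw_def intro: inj_on_subset)
    show "emeasure lborel (w ` T) < \<infinity>"
      unfolding wT using A\<X> compact emeasure_bounded_finite bounded_subset compact_imp_bounded by blast
    \<comment> \<open>The Jacobian is controlled only on \<open>\<X>\<close>; multiplying by the
      indicator of \<open>T\<close> yields a function that is Borel on the whole space.\<close>
    have "continuous_on \<X> (\<lambda>x. \<bar>det (Dinv \<zeta> x)\<bar>)"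
      by (intro continuous_intros continuous_on_det Dinv_cont)
    then have "(\<lambda>x. indicator T x *\<^sub>R \<bar>det (Dinv \<zeta> x)\<bar>) \<in> borel_measurable borel"
      using T_borel T\<X> by (intro borel_measurable_continuous_on_indicator) (auto intro: continuous_on_subset)
    then have "(\<lambda>x. ennreal (indicator T x *\<^sub>R \<bar>det (Dinv \<zeta> x)\<bar>)) \<in> borel_measurable borel"
      by measurable
    also have "(\<lambda>x. ennreal (indicator T x *\<^sub>R \<bar>det (Dinv \<zeta> x)\<bar>)) = (\<lambda>x. ennreal \<bar>det (Dinv \<zeta> x)\<bar> * indicator T x)"
      by (auto simp: indicator_def)
    finally show "(\<lambda>x. ennreal \<bar>det (Dinv \<zeta> x)\<bar> * indicator T x) \<in> borel_measurable borel" .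
  qed (simp add: wT A_borel)
  also have "\<dots> = (\<integral>\<^sup>+x. ennreal \<bar>det (Dinv \<zeta> x)\<bar> * indicator T x \<partial>L)"
    using T\<X> by (subst nn_integral_restrict_space) (auto intro!: nn_integral_cong simp: indicator_def)
  also have "\<dots> = emeasure (density_on \<X> (\<lambda>x. \<bar>det (Dinv \<zeta> x)\<bar>)) T"
    unfolding density_on_def using T by (subst emeasure_density) auto
  also have "\<dots> = emeasure (distr (density_on \<X> (\<lambda>x. \<bar>det (Dinv \<zeta> x)\<bar>)) L w) A"
    by (subst emeasure_distr) (auto simp: T_def)
  also have "emeasure lborel (w ` T) = emeasure L A"
    unfolding wT using A\<X> by (subst emeasure_restrict_space) auto
  finally show "emeasure (distr (density_on \<X> (\<lambda>x. \<bar>det (Dinv \<zeta> x)\<bar>)) L w) A = emeasure L A"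
    by simp
qed simp

text \<open>This identifies \<open>q\<close> as the density of the proposal: Lebesgue measure is
  written as an image under \<open>w\<close>, and then \<open>\<zeta> (w y) = y\<close>.\<close>

lemma nn_integral_flow:
  assumes g [measurable]: "g \<in> borel_measurable L"
  shows "(\<integral>\<^sup>+t. g (\<zeta> t) \<partial>density_on \<X> pt) = (\<integral>\<^sup>+y. ennreal (q y) * g y \<partial>L)"
proof -
  have "(\<integral>\<^sup>+t. g (\<zeta> t) \<partial>density_on \<X> pt) = (\<integral>\<^sup>+t. ennreal (pt t) * g (\<zeta> t) \<partial>L)"
    unfolding density_on_def by (subst nn_integral_density) auto
  also have "\<dots> = (\<integral>\<^sup>+t. ennreal (pt t) * g (\<zeta> t) \<partial>distr (density_on \<X> (\<lambda>x. \<bar>det (Dinv \<zeta> x)\<bar>)) L w)"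
    by (simp add: distr_inverse_flow)
  also have "\<dots> = (\<integral>\<^sup>+y. ennreal (pt (w y)) * g (\<zeta> (w y)) \<partial>density_on \<X> (\<lambda>x. \<bar>det (Dinv \<zeta> x)\<bar>))"
    by (subst nn_integral_distr) auto
  also have "\<dots> = (\<integral>\<^sup>+y. ennreal \<bar>det (Dinv \<zeta> y)\<bar> * (ennreal (pt (w y)) * g (\<zeta> (w y))) \<partial>L)"
    unfolding density_on_def by (subst nn_integral_density) auto
  also have "\<dots> = (\<integral>\<^sup>+y. ennreal (q y) * g y \<partial>L)"
    using pt_pos[OF w_in]
    by (intro nn_integral_cong) (simp add: space_L \<zeta>_w flow_density_def ennreal_mult' less_imp_le mult_ac)
  finally show ?thesis .
qed

section \<open>Accept-reject kernel: minorization and invariance\<close>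

lemma a_bounds: "x \<in> \<X> \<Longrightarrow> y \<in> \<X> \<Longrightarrow> 0 \<le> a x y \<and> a x y \<le> 1"
  unfolding acceptance_prob_def using p_pos q_pos by (auto intro!: less_imp_le)

lemma a_measurable [measurable]: "(\<lambda>(x, y). a x y) \<in> borel_measurable (L \<Otimes>\<^sub>M L)"
  unfolding acceptance_prob_def by measurable

text \<open>The two draws are integrated out from the inside: the Bernoulli draw leaves a mixture of
  two point masses, and \<open>nn_integral_flow\<close> then turns the draw from the reference law
  into one with density \<open>q\<close>.\<close>

lemma emeasure_imh_kernel:
  assumes x: "x \<in> \<X>" and B [measurable]: "B \<in> sets L"
  shows "emeasure (imh_kernel \<X> p pt Dinv \<zeta> x) B
    = (\<integral>\<^sup>+y. ennreal (q y) * (ennreal (a x y) * indicator B y + ennreal (1 - a x y) * indicator B x) \<partial>L)"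
proof -
  let ?N = "restrict_space borel \<X>"
  let ?I = "\<lambda>t. measure_pmf (bernoulli_pmf (a x (\<zeta> t))) \<bind> (\<lambda>accept. return ?N (if accept then \<zeta> t else x))"
  let ?g = "\<lambda>C y. ennreal (a x y) * indicator C y + ennreal (1 - a x y) * indicator C x"
  interpret pt: prob_space "density_on \<X> pt" by (rule pt_prob)
  have xL: "x \<in> space L" using x by (simp add: space_L)
  have ax [measurable]: "a x \<in> borel_measurable L"
    using measurable_Pair2[OF a_measurable xL] by simp
  have ret: "(\<lambda>accept. return ?N (if accept then \<zeta> t else x)) \<in> measure_pmf P \<rightarrow>\<^sub>M subprob_algebra ?N"
    if "t \<in> \<X>" for t P
    using that x by (auto simp: space_subprob_algebra subprob_space_return space_restrict_space \<zeta>_in)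
  \<comment> \<open>With \<open>t\<close> fixed, only the two outcomes of the Bernoulli draw
    remain.\<close>
  have I: "emeasure (?I t) C = ?g C (\<zeta> t)" if t: "t \<in> \<X>" and C: "C \<in> sets ?N" for t C
    using a_bounds[OF x \<zeta>_in[OF t]] C
    by (subst emeasure_bind[OF _ ret[OF t] C]) (auto simp: mult.commute)
  have sets_I: "sets (?I t) = sets ?N" if "t \<in> \<X>" for t
    by (subst sets_bind[where N = ?N]) auto
  have space_I: "space (?I t) = \<X>" if "t \<in> \<X>" for t
    using sets_eq_imp_space_eq[OF sets_I[OF that]] by (simp add: space_restrict_space)
  \<comment> \<open>The outer \<open>emeasure_bind\<close> presupposes that the inner law is a
    measurable kernel in \<open>t\<close>; this follows from the explicit formula \<open>I\<close>
    for its values on sets.\<close>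
  have "?I \<in> density_on \<X> pt \<rightarrow>\<^sub>M subprob_algebra ?N"
  proof (rule measurable_subprob_algebra)
    fix t assume "t \<in> space (density_on \<X> pt)"
    then have t: "t \<in> \<X>" by simp
    show "sets (?I t) = sets ?N" by (rule sets_I[OF t])
    have "\<X> \<in> sets ?N"
      using sets.top[of ?N] by (simp add: space_restrict_space)
    then have "emeasure (?I t) (space (?I t)) = 1"
      unfolding space_I[OF t] I[OF t \<open>\<X> \<in> sets ?N\<close>]
      using x \<zeta>_in[OF t] a_bounds[OF x \<zeta>_in[OF t]] by (simp add: ennreal_plus[symmetric] del: ennreal_plus)
    then show "subprob_space (?I t)"
      using space_I[OF t] x by (intro subprob_spaceI) auto
  next
    fix C assume C: "C \<in> sets ?N"
    then have [measurable]: "C \<in> sets L" by (simp add: sets_L)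
    have "(\<lambda>t. ?g C (\<zeta> t)) \<in> borel_measurable (density_on \<X> pt)"
      by measurable
    then show "(\<lambda>t. emeasure (?I t) C) \<in> borel_measurable (density_on \<X> pt)"
      by (rule measurable_cong[THEN iffD1, rotated]) (simp add: I C)
  qed
  then have "emeasure (imh_kernel \<X> p pt Dinv \<zeta> x) B = (\<integral>\<^sup>+t. emeasure (?I t) B \<partial>density_on \<X> pt)"
    unfolding imh_kernel_def using B pt.not_empty by (intro emeasure_bind) (auto simp: sets_L)
  also have "\<dots> = (\<integral>\<^sup>+t. ?g B (\<zeta> t) \<partial>density_on \<X> pt)"
    using B by (intro nn_integral_cong I) (auto simp: sets_L)
  also have "\<dots> = (\<integral>\<^sup>+y. ennreal (q y) * ?g B y \<partial>L)"
    by (rule nn_integral_flow) measurable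
  finally show ?thesis .
qed

lemma emeasure_density_on: "B \<in> sets L \<Longrightarrow> emeasure (density_on \<X> p) B = (\<integral>\<^sup>+y. ennreal (p y) * indicator B y \<partial>L)"
  unfolding density_on_def by (subst emeasure_density) auto

text \<open>The density of accepted moves is \<open>min (q y) (p y * q x / p x)\<close>. Since
  \<open>q\<close> is at least \<open>m * l\<close>, hence at least \<open>\<beta> * P\<close>, both
  entries dominate \<open>\<beta> * p y\<close>.\<close>

lemma imh_kernel_minorization:
  assumes x: "x \<in> \<X>" and B: "B \<in> sets L" and \<beta>: "0 \<le> \<beta>"
    and P: "\<And>y. y \<in> \<X> \<Longrightarrow> p y \<le> P" "0 < P" and m: "\<And>y. y \<in> \<X> \<Longrightarrow> m \<le> pt y" "0 < m" and \<beta>_le: "\<beta> \<le> m * l / P"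
  shows "ennreal \<beta> * emeasure (density_on \<X> p) B \<le> emeasure (imh_kernel \<X> p pt Dinv \<zeta> x) B"
proof -
  have q_ge: "\<beta> * P \<le> q y" if y: "y \<in> \<X>" for y
  proof -
    have "\<beta> * P \<le> m * l"
      using \<beta>_le P(2) by (simp add: field_simps)
    also have "\<dots> \<le> q y"
      unfolding flow_density_def using m(1)[OF w_in[OF y]] m(2) l y by (intro mult_mono) (auto intro: less_imp_le)
    finally show ?thesis .
  qed
  have le: "\<beta> * p y \<le> q y * a x y" if y: "y \<in> \<X>" for y
  proof -
    have "\<beta> * p y \<le> q y"
      using q_ge[OF y] mult_left_mono[OF P(1)[OF y] \<beta>] by linarith
    moreover have "\<beta> * p x \<le> q x"
      using q_ge[OF x] mult_left_mono[OF P(1)[OF x] \<beta>] by linarith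
    then have "\<beta> * p y \<le> p y * q x / p x"
      using p_pos[OF x] p_pos[OF y] by (simp add: field_simps)
    moreover have "q y * a x y = min (q y) (p y * q x / p x)"
      unfolding acceptance_prob_def using p_pos[OF x] q_pos[OF y] by (simp add: min_mult_distrib_left)
    ultimately show ?thesis by simp
  qed
  have "ennreal \<beta> * emeasure (density_on \<X> p) B = (\<integral>\<^sup>+y. ennreal \<beta> * (ennreal (p y) * indicator B y) \<partial>L)"
    unfolding emeasure_density_on[OF B] using B by (intro nn_integral_cmult[symmetric]) auto
  also have "\<dots> \<le> (\<integral>\<^sup>+y. ennreal (q y) * (ennreal (a x y) * indicator B y + ennreal (1 - a x y) * indicator B x) \<partial>L)"
  proof (rule nn_integral_mono)
    fix y assume "y \<in> space L"
    then have y: "y \<in> \<X>" by (simp add: space_L)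
    have "ennreal \<beta> * ennreal (p y) \<le> ennreal (q y) * ennreal (a x y)"
      using le[OF y] \<beta> p_pos[OF y] q_pos[OF y] a_bounds[OF x y] by (simp flip: ennreal_mult)
    then have "ennreal \<beta> * (ennreal (p y) * indicator B y) \<le> ennreal (q y) * (ennreal (a x y) * indicator B y)"
      by (auto simp: indicator_def)
    \<comment> \<open>The mass left at \<open>x\<close> by rejections only enlarges the
      kernel.\<close>
    also have "\<dots> \<le> ennreal (q y) * (ennreal (a x y) * indicator B y + ennreal (1 - a x y) * indicator B x)"
      by (intro mult_left_mono) auto
    finally show "ennreal \<beta> * (ennreal (p y) * indicator B y) \<le> ennreal (q y) * (ennreal (a x y) * indicator B y + ennreal (1 - a x y) * indicator B x)" .
  qed
  finally show ?thesis
    unfolding emeasure_imh_kernel[OF x B] .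
qed

text \<open>The flow \<open>p x * q y * a x y\<close> from \<open>x\<close> to \<open>y\<close> equals \<open>min (p x * q y) (p y * q x)\<close>, which is symmetric.
  Splitting it off additively avoids subtraction in \<open>ennreal\<close>.\<close>

lemma imh_kernel_invariant:
  assumes B [measurable]: "B \<in> sets L"
  shows "(\<integral>\<^sup>+x. emeasure (imh_kernel \<X> p pt Dinv \<zeta> x) B \<partial>density_on \<X> p) = emeasure (density_on \<X> p) B"
proof -
  interpret pt: prob_space "density_on \<X> pt" by (rule pt_prob)
  interpret L: sigma_finite_measure L
    by (rule sigma_finite_measure_restrict_space) (auto intro: sigma_finite_lborel)
  interpret LL: pair_sigma_finite L L ..
  \<comment> \<open>\<open>s\<close> is the accepted and \<open>r\<close> the rejected part of the
    stationary flow; together they make up the proposal flow \<open>p x * q y\<close>.\<close>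
  define s where "s x y = ennreal (p x * (q y * a x y))" for x y
  define r where "r x y = ennreal (p x * (q y * (1 - a x y)))" for x y
  have [measurable]: "(\<lambda>(x, y). s x y) \<in> borel_measurable (L \<Otimes>\<^sub>M L)" "(\<lambda>(x, y). r x y) \<in> borel_measurable (L \<Otimes>\<^sub>M L)"
    unfolding s_def r_def by measurable
  have s_sym: "s x y = s y x" if "x \<in> \<X>" "y \<in> \<X>" for x y
  proof -
    have "p x * (q y * a x y) = min (p x * q y) (p y * q x)" if "x \<in> \<X>" "y \<in> \<X>" for x y
      unfolding acceptance_prob_def using p_pos[OF that(1)] q_pos[OF that(2)]
      by (simp add: min_mult_distrib_left flip: mult.assoc)
    then show ?thesis
      using that by (simp add: s_def min.commute)
  qed
  have q_total: "(\<integral>\<^sup>+y. ennreal (q y) \<partial>L) = 1"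
    using nn_integral_flow[of "\<lambda>_. 1"] pt.emeasure_space_1 by simp
  have sr: "s x y + r x y = ennreal (p x) * ennreal (q y)" if "x \<in> \<X>" "y \<in> \<X>" for x y
    unfolding s_def r_def using that p_pos[of x] q_pos[of y] a_bounds[of x y]
    by (subst ennreal_plus[symmetric]) (auto simp: algebra_simps less_imp_le simp flip: ennreal_mult)
  have "(\<integral>\<^sup>+x. emeasure (imh_kernel \<X> p pt Dinv \<zeta> x) B \<partial>density_on \<X> p)
    = (\<integral>\<^sup>+x. (\<integral>\<^sup>+y. ennreal (q y) * (ennreal (a x y) * indicator B y + ennreal (1 - a x y) * indicator B x) \<partial>L) \<partial>density_on \<X> p)"
    using B by (intro nn_integral_cong emeasure_imh_kernel) auto
  also have "\<dots> = (\<integral>\<^sup>+x. ennreal (p x) * (\<integral>\<^sup>+y. ennreal (q y) * (ennreal (a x y) * indicator B y + ennreal (1 - a x y) * indicator B x) \<partial>L) \<partial>L)"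
    unfolding density_on_def by (subst nn_integral_density) auto
  also have "\<dots> = (\<integral>\<^sup>+x. (\<integral>\<^sup>+y. s x y * indicator B y + r x y * indicator B x \<partial>L) \<partial>L)"
  proof (rule nn_integral_cong)
    fix x assume xL: "x \<in> space L"
    then have x: "x \<in> \<X>" by (simp add: space_L)
    have [measurable]: "a x \<in> borel_measurable L"
      using measurable_Pair2[OF a_measurable xL] by simp
    have "ennreal (p x) * (\<integral>\<^sup>+y. ennreal (q y) * (ennreal (a x y) * indicator B y + ennreal (1 - a x y) * indicator B x) \<partial>L)
       = (\<integral>\<^sup>+y. ennreal (p x) * (ennreal (q y) * (ennreal (a x y) * indicator B y + ennreal (1 - a x y) * indicator B x)) \<partial>L)"
      by (rule nn_integral_cmult[symmetric]) measurable
    also have "\<dots> = (\<integral>\<^sup>+y. s x y * indicator B y + r x y * indicator B x \<partial>L)"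
    proof (rule nn_integral_cong)
      fix y assume "y \<in> space L"
      then have y: "y \<in> \<X>" by (simp add: space_L)
      have "s x y = ennreal (p x) * (ennreal (q y) * ennreal (a x y))"
           "r x y = ennreal (p x) * (ennreal (q y) * ennreal (1 - a x y))"
        unfolding s_def r_def using p_pos[OF x] q_pos[OF y] a_bounds[OF x y] by (simp_all add: ennreal_mult')
      then show "ennreal (p x) * (ennreal (q y) * (ennreal (a x y) * indicator B y + ennreal (1 - a x y) * indicator B x))
          = s x y * indicator B y + r x y * indicator B x"
        by (simp add: distrib_left mult.assoc)
    qed
    finally show "ennreal (p x) * (\<integral>\<^sup>+y. ennreal (q y) * (ennreal (a x y) * indicator B y + ennreal (1 - a x y) * indicator B x) \<partial>L)
       = (\<integral>\<^sup>+y. s x y * indicator B y + r x y * indicator B x \<partial>L)" .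
  qed
  also have "\<dots> = (\<integral>\<^sup>+x. (\<integral>\<^sup>+y. s x y * indicator B y \<partial>L) + (\<integral>\<^sup>+y. r x y * indicator B x \<partial>L) \<partial>L)"
    by (intro nn_integral_cong nn_integral_add) measurable
  also have "\<dots> = (\<integral>\<^sup>+x. (\<integral>\<^sup>+y. s x y * indicator B y \<partial>L) \<partial>L) + (\<integral>\<^sup>+x. (\<integral>\<^sup>+y. r x y * indicator B x \<partial>L) \<partial>L)"
    by (intro nn_integral_add) measurable
  \<comment> \<open>Exchanging the integrals and using the symmetry of \<open>s\<close> moves the
    indicator from the arrival point to the starting point: reversibility in integrated
    form.\<close>
  also have "(\<integral>\<^sup>+x. (\<integral>\<^sup>+y. s x y * indicator B y \<partial>L) \<partial>L) = (\<integral>\<^sup>+y. (\<integral>\<^sup>+x. s x y * indicator B y \<partial>L) \<partial>L)"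
    by (rule LL.Fubini'[symmetric]) measurable
  also have "\<dots> = (\<integral>\<^sup>+x. (\<integral>\<^sup>+y. s x y * indicator B x \<partial>L) \<partial>L)"
    by (intro nn_integral_cong) (simp add: space_L s_sym)
  also have "\<dots> + (\<integral>\<^sup>+x. (\<integral>\<^sup>+y. r x y * indicator B x \<partial>L) \<partial>L)
      = (\<integral>\<^sup>+x. (\<integral>\<^sup>+y. s x y * indicator B x \<partial>L) + (\<integral>\<^sup>+y. r x y * indicator B x \<partial>L) \<partial>L)"
    by (intro nn_integral_add[symmetric]) measurable
  also have "\<dots> = (\<integral>\<^sup>+x. ennreal (p x) * indicator B x \<partial>L)"
  proof (rule nn_integral_cong)
    fix x assume xL: "x \<in> space L"
    then have x: "x \<in> \<X>" by (simp add: space_L)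
    have [measurable]: "s x \<in> borel_measurable L" "r x \<in> borel_measurable L"
      using xL by measurable
    have "(\<integral>\<^sup>+y. s x y * indicator B x \<partial>L) + (\<integral>\<^sup>+y. r x y * indicator B x \<partial>L)
        = (\<integral>\<^sup>+y. s x y * indicator B x + r x y * indicator B x \<partial>L)"
      by (rule nn_integral_add[symmetric]) measurable
    \<comment> \<open>Both indicators now sit at \<open>x\<close>, so \<open>sr\<close> recombines
      the two parts, and \<open>q\<close> integrates to one.\<close>
    also have "\<dots> = (\<integral>\<^sup>+y. (ennreal (p x) * indicator B x) * ennreal (q y) \<partial>L)"
      using sr[OF x] by (intro nn_integral_cong) (auto simp: space_L indicator_def)
    also have "\<dots> = ennreal (p x) * indicator B x"
      by (subst nn_integral_cmult) (auto simp: q_total)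
    finally show "(\<integral>\<^sup>+y. s x y * indicator B x \<partial>L) + (\<integral>\<^sup>+y. r x y * indicator B x \<partial>L) = ennreal (p x) * indicator B x" .
  qed
  finally show ?thesis
    by (simp add: emeasure_density_on)
qed

end

section \<open>Adaptive chains with uniformly minorized kernels\<close>

text \<open>\<open>drawn_from\<close> prescribes the joint law of \<open>H\<close> and
  \<open>Y\<close> on measurable rectangles. These form an intersection-stable generator, so the
  joint law is a \<open>bind\<close>, and bounded functions can be integrated in two stages.\<close>

lemma drawn_from_expectation:
  fixes f :: "'h \<times> 'y \<Rightarrow> real"
  assumes "prob_space M" and dr: "drawn_from M MH MY H Y K"
    and f: "f \<in> borel_measurable (MH \<Otimes>\<^sub>M MY)"
    and bounded: "\<And>h y. h \<in> space MH \<Longrightarrow> y \<in> space MY \<Longrightarrow> \<bar>f (h, y)\<bar> \<le> B"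
  shows "(\<integral>\<omega>. f (H \<omega>, Y \<omega>) \<partial>M) = (\<integral>\<omega>. (\<integral>y. f (H \<omega>, y) \<partial>K (H \<omega>)) \<partial>M)"
proof -
  interpret prob_space M by fact
  have H [measurable]: "H \<in> M \<rightarrow>\<^sub>M MH" and Y [measurable]: "Y \<in> M \<rightarrow>\<^sub>M MY"
    and K [measurable]: "K \<in> MH \<rightarrow>\<^sub>M prob_algebra MY"
    and rect: "\<And>A B. A \<in> sets MH \<Longrightarrow> B \<in> sets MY \<Longrightarrow>
        emeasure M {\<omega> \<in> space M. H \<omega> \<in> A \<and> Y \<omega> \<in> B} =
        (\<integral>\<^sup>+ \<omega>. indicator A (H \<omega>) * emeasure (K (H \<omega>)) B \<partial>M)"
    using dr by (auto simp: drawn_from_def)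
  \<comment> \<open>\<open>L \<omega>\<close> is the conditional law of the pair: a point mass at
    \<open>H \<omega>\<close> times \<open>K (H \<omega>)\<close>.\<close>
  define L where "L \<omega> = distr (K (H \<omega>)) (MH \<Otimes>\<^sub>M MY) (Pair (H \<omega>))" for \<omega>
  have L: "L \<in> M \<rightarrow>\<^sub>M prob_algebra (MH \<Otimes>\<^sub>M MY)"
    unfolding L_def by measurable
  have L': "L \<in> M \<rightarrow>\<^sub>M subprob_algebra (MH \<Otimes>\<^sub>M MY)"
    by (rule measurable_prob_algebraD[OF L])
  have KH: "sets (K (H \<omega>)) = sets MY" "space (K (H \<omega>)) = space MY" "prob_space (K (H \<omega>))"
    if "\<omega> \<in> space M" for \<omega>
    using measurable_space[OF measurable_compose[OF H K] that]
    by (auto simp: space_prob_algebra dest: sets_eq_imp_space_eq)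
  have Pair: "Pair (H \<omega>) \<in> K (H \<omega>) \<rightarrow>\<^sub>M MH \<Otimes>\<^sub>M MY" if "\<omega> \<in> space M" for \<omega>
    using measurable_space[OF H that] KH(1)[OF that] by (simp cong: measurable_cong_sets)
  have eq: "distr M (MH \<Otimes>\<^sub>M MY) (\<lambda>\<omega>. (H \<omega>, Y \<omega>)) = M \<bind> L"
  proof (rule measure_eqI_generator_eq)
    show "Int_stable {a \<times> b | a b. a \<in> sets MH \<and> b \<in> sets MY}"
      by (rule Int_stable_pair_measure_generator)
    show "{a \<times> b | a b. a \<in> sets MH \<and> b \<in> sets MY} \<subseteq> Pow (space MH \<times> space MY)"
      by (auto dest: sets.sets_into_space)
    show "sets (distr M (MH \<Otimes>\<^sub>M MY) (\<lambda>\<omega>. (H \<omega>, Y \<omega>)))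
        = sigma_sets (space MH \<times> space MY) {a \<times> b | a b. a \<in> sets MH \<and> b \<in> sets MY}"
      by (simp add: sets_pair_measure)
    show "sets (M \<bind> L)
        = sigma_sets (space MH \<times> space MY) {a \<times> b | a b. a \<in> sets MH \<and> b \<in> sets MY}"
      using sets_bind[of M L "MH \<Otimes>\<^sub>M MY"] not_empty
      by (simp add: L_def sets_pair_measure)
    \<comment> \<open>Both measures are finite, so the constant sequence of the whole space exhausts
      it.\<close>
    show "range (\<lambda>_::nat. space MH \<times> space MY) \<subseteq> {a \<times> b | a b. a \<in> sets MH \<and> b \<in> sets MY}"
      by auto
    show "emeasure (distr M (MH \<Otimes>\<^sub>M MY) (\<lambda>\<omega>. (H \<omega>, Y \<omega>))) (space MH \<times> space MY) \<noteq> \<infinity>"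
      by (subst emeasure_distr) auto
  next
    fix C assume "C \<in> {a \<times> b | a b. a \<in> sets MH \<and> b \<in> sets MY}"
    then obtain a b where C: "C = a \<times> b" and [measurable]: "a \<in> sets MH" "b \<in> sets MY" by auto
    have "emeasure (distr M (MH \<Otimes>\<^sub>M MY) (\<lambda>\<omega>. (H \<omega>, Y \<omega>))) C
        = emeasure M {\<omega> \<in> space M. H \<omega> \<in> a \<and> Y \<omega> \<in> b}"
      unfolding C by (subst emeasure_distr) (auto intro!: arg_cong2[where f = emeasure])
    also have "\<dots> = (\<integral>\<^sup>+ \<omega>. emeasure (L \<omega>) C \<partial>M)"
      unfolding rect[OF \<open>a \<in> sets MH\<close> \<open>b \<in> sets MY\<close>]
    proof (rule nn_integral_cong)
      fix \<omega> assume \<omega>: "\<omega> \<in> space M"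
      have "emeasure (L \<omega>) C = emeasure (K (H \<omega>)) (Pair (H \<omega>) -` C \<inter> space (K (H \<omega>)))"
        unfolding L_def using Pair[OF \<omega>] by (subst emeasure_distr) (auto simp: C)
      also have "Pair (H \<omega>) -` C \<inter> space (K (H \<omega>)) = (if H \<omega> \<in> a then b else {})"
        using sets.sets_into_space[OF \<open>b \<in> sets MY\<close>] KH(2)[OF \<omega>] by (auto simp: C)
      finally show "indicator a (H \<omega>) * emeasure (K (H \<omega>)) b = emeasure (L \<omega>) C"
        by simp
    qed
    also have "\<dots> = emeasure (M \<bind> L) C"
      by (rule emeasure_bind[OF not_empty L', symmetric]) (simp add: C)
    finally show "emeasure (distr M (MH \<Otimes>\<^sub>M MY) (\<lambda>\<omega>. (H \<omega>, Y \<omega>))) C = emeasure (M \<bind> L) C" .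
  qed (auto simp: space_pair_measure)
  have "(\<integral>\<omega>. f (H \<omega>, Y \<omega>) \<partial>M) = integral\<^sup>L (distr M (MH \<Otimes>\<^sub>M MY) (\<lambda>\<omega>. (H \<omega>, Y \<omega>))) f"
    using f by (subst integral_distr) auto
  also have "\<dots> = (\<integral>\<omega>. integral\<^sup>L (L \<omega>) f \<partial>M)"
    unfolding eq
  proof (rule integral_bind[where B = B and B' = 1, OF f _ L'])
    show "finite_measure M" by (rule finite_measure_axioms)
    show "AE x in M. emeasure (L x) (space (L x)) \<le> ennreal 1"
      using measurable_space[OF L] by (auto intro!: AE_I2 simp: space_prob_algebra prob_space.emeasure_space_1)
  qed (use bounded in \<open>auto simp: space_pair_measure\<close>)
  also have "\<dots> = (\<integral>\<omega>. (\<integral>y. f (H \<omega>, y) \<partial>K (H \<omega>)) \<partial>M)"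
    unfolding L_def by (intro Bochner_Integration.integral_cong refl integral_distr Pair f)
  finally show ?thesis .
qed

text \<open>If the \<open>i\<close>-th triangular number is at most \<open>n\<close>, then
  \<open>i * i \<le> i * (i + 1) \<le> 2 * n\<close>. Hence all adaptation times up to
  \<open>n\<close> have an index of at most the square root of \<open>2 * n\<close>.\<close>

lemma card_adaptation_times_le:
  "(card {j \<in> {1..n}. adaptation_time j})\<^sup>2 \<le> 2 * n"
proof -
  define r where "r = nat \<lfloor>sqrt (2 * n)\<rfloor>"
  have r: "real r \<le> sqrt (2 * n)"
    unfolding r_def by simp
  have "{j \<in> {1..n}. adaptation_time j} \<subseteq> (\<lambda>i. i * (i + 1) div 2) ` {1..r}"
  proof
    fix j assume "j \<in> {j \<in> {1..n}. adaptation_time j}"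
    then obtain i where i: "i \<ge> 1" "j = i * (i + 1) div 2" "j \<le> n"
      by (auto simp: adaptation_time_def)
    have "i\<^sup>2 \<le> i * (i + 1)"
      by (simp add: power2_eq_square)
    also have "\<dots> = 2 * j"
      unfolding i(2) by simp
    finally have "real (i\<^sup>2) \<le> real (2 * n)"
      using i(3) by (intro of_nat_mono) linarith
    then have "real i \<le> sqrt (2 * n)"
      by (intro real_le_rsqrt) simp
    then have "i \<le> r"
      unfolding r_def by (simp add: le_nat_floor)
    then show "j \<in> (\<lambda>i. i * (i + 1) div 2) ` {1..r}"
      using i by auto
  qed
  then have "card {j \<in> {1..n}. adaptation_time j} \<le> card {1..r}"
    by (meson card_image_le card_mono finite_atLeastAtMost finite_imageI order_trans)
  then have "(card {j \<in> {1..n}. adaptation_time j})\<^sup>2 \<le> r\<^sup>2"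
    by (intro power_mono) auto
  moreover have "real (r\<^sup>2) \<le> real (2 * n)"
    using power_mono[OF r, of 2] by simp
  ultimately show ?thesis
    using of_nat_le_iff order_trans by blast
qed

text \<open>The integrand depends on the parameter too. Pairing \<open>L x\<close> with a point mass
  at \<open>x\<close> moves this dependence into the measure, after which one fixed function is
  integrated.\<close>

lemma integral_measurable_subprob_algebra2:
  fixes f :: "'a \<Rightarrow> 'b \<Rightarrow> real"
  assumes f [measurable]: "(\<lambda>(x, y). f x y) \<in> borel_measurable (M \<Otimes>\<^sub>M N)"
    and L [measurable]: "L \<in> M \<rightarrow>\<^sub>M subprob_algebra N"
  shows "(\<lambda>x. integral\<^sup>L (L x) (f x)) \<in> borel_measurable M"
proof -
  have D: "(\<lambda>x. distr (L x) (M \<Otimes>\<^sub>M N) (\<lambda>y. (x, y))) \<in> M \<rightarrow>\<^sub>M subprob_algebra (M \<Otimes>\<^sub>M N)"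
    by (rule measurable_distr2[OF _ L]) simp
  have "(\<lambda>x. integral\<^sup>L (distr (L x) (M \<Otimes>\<^sub>M N) (\<lambda>y. (x, y))) (\<lambda>(x, y). f x y)) \<in> borel_measurable M"
    by (rule measurable_compose[OF D integral_measurable_subprob_algebra[OF f]])
  then show ?thesis
  proof (rule measurable_cong[THEN iffD1, rotated])
    fix x assume x: "x \<in> space M"
    have P: "Pair x \<in> L x \<rightarrow>\<^sub>M M \<Otimes>\<^sub>M N"
      using x measurable_space[OF L x] by (simp cong: measurable_cong_sets add: space_subprob_algebra)
    show "integral\<^sup>L (distr (L x) (M \<Otimes>\<^sub>M N) (\<lambda>y. (x, y))) (\<lambda>(x, y). f x y) = integral\<^sup>L (L x) (f x)"
      using integral_distr[OF P f] by simp
  qed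
qed

text \<open>Flows are abstracted away. The argument rests on a common invariant law, a common
  minorization constant, and parameters that change only at adaptation times.\<close>

locale adaptive_chain = prob_space M for M :: "'w measure" +
  fixes N :: "'x measure" and MZ :: "'z measure" and \<kappa> :: "'z \<Rightarrow> 'x \<Rightarrow> 'x measure"
    and \<pi> :: "'x measure" and \<beta> :: real and X :: "nat \<Rightarrow> 'w \<Rightarrow> 'x" and Z :: "nat \<Rightarrow> 'w \<Rightarrow> 'z"
  assumes kernel: "(\<lambda>(\<zeta>, x). \<kappa> \<zeta> x) \<in> MZ \<Otimes>\<^sub>M N \<rightarrow>\<^sub>M prob_algebra N"
    and target: "\<pi> \<in> space (prob_algebra N)"
    and invariant: "\<And>\<zeta> A. \<zeta> \<in> space MZ \<Longrightarrow> A \<in> sets N \<Longrightarrow> (\<integral>\<^sup>+x. emeasure (\<kappa> \<zeta> x) A \<partial>\<pi>) = emeasure \<pi> A"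
    and \<beta>: "0 < \<beta>" "\<beta> \<le> 1"
    and minorization: "\<And>\<zeta> x A. \<zeta> \<in> space MZ \<Longrightarrow> x \<in> space N \<Longrightarrow> A \<in> sets N \<Longrightarrow>
      ennreal \<beta> * emeasure \<pi> A \<le> emeasure (\<kappa> \<zeta> x) A"
    and X_measurable [measurable]: "\<And>n. X n \<in> M \<rightarrow>\<^sub>M N"
    and Z_measurable [measurable]: "\<And>n. Z n \<in> M \<rightarrow>\<^sub>M MZ"
    and Z_constant: "\<And>n. n \<ge> 1 \<Longrightarrow> \<not> adaptation_time n \<Longrightarrow> AE \<omega> in M. Z n \<omega> = Z (n - 1) \<omega>"
    and transition: "\<And>n. drawn_from M (PiM {..n} (\<lambda>_. N) \<Otimes>\<^sub>M PiM {..n} (\<lambda>_. MZ)) N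
      (\<lambda>\<omega>. (\<lambda>i\<in>{..n}. X i \<omega>, \<lambda>i\<in>{..n}. Z i \<omega>)) (X (Suc n)) (\<lambda>(xs, zs). \<kappa> (zs n) (xs n))"
begin

section \<open>Minorization and invariance for bounded functions\<close>

lemma kernel_sets:
  assumes "\<zeta> \<in> space MZ" "x \<in> space N"
  shows "sets (\<kappa> \<zeta> x) = sets N" "space (\<kappa> \<zeta> x) = space N" "prob_space (\<kappa> \<zeta> x)"
  using measurable_space[OF kernel, of "(\<zeta>, x)"] assms
  by (auto simp: space_pair_measure space_prob_algebra dest: sets_eq_imp_space_eq)

lemma target_sets: "sets \<pi> = sets N" "space \<pi> = space N" "prob_space \<pi>"
  using target by (auto simp: space_prob_algebra dest: sets_eq_imp_space_eq)

lemma section_measurable: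
  assumes "(\<lambda>(\<zeta>, x). f \<zeta> x) \<in> borel_measurable (MZ \<Otimes>\<^sub>M N)" "\<zeta> \<in> space MZ"
  shows "f \<zeta> \<in> borel_measurable N"
  using measurable_Pair2[OF assms] by simp

lemma integrable_bounded:
  fixes f :: "'x \<Rightarrow> real"
  assumes "sets K = sets N" "prob_space K" "f \<in> borel_measurable N" "\<And>x. x \<in> space N \<Longrightarrow> \<bar>f x\<bar> \<le> c"
  shows "integrable K f"
proof -
  interpret K: prob_space K by fact
  have "f \<in> borel_measurable K"
    using assms(3) by (simp cong: measurable_cong_sets add: assms(1))
  then show ?thesis
    using assms(4) sets_eq_imp_space_eq[OF assms(1)]
    by (intro K.integrable_const_bound[of _ c]) auto
qed

lemma integral_abs_le:
  fixes f :: "'x \<Rightarrow> real"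
  assumes "sets K = sets N" "prob_space K" "f \<in> borel_measurable N" "\<And>x. x \<in> space N \<Longrightarrow> \<bar>f x\<bar> \<le> c"
  shows "\<bar>\<integral>x. f x \<partial>K\<bar> \<le> c"
proof -
  interpret K: prob_space K by fact
  have i: "integrable K f" by (rule integrable_bounded[OF assms])
  have b: "\<And>x. x \<in> space K \<Longrightarrow> \<bar>f x\<bar> \<le> c"
    using assms(4) sets_eq_imp_space_eq[OF assms(1)] by simp
  have "(\<integral>x. f x \<partial>K) \<le> c"
    by (rule K.integral_le_const[OF i]) (use b in \<open>auto intro!: AE_I2 dest: abs_le_D1\<close>)
  moreover have "-c \<le> (\<integral>x. f x \<partial>K)"
    by (rule K.integral_ge_const[OF i]) (use b in \<open>force intro!: AE_I2\<close>)
  ultimately show ?thesis by linarith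
qed

text \<open>The minorization on sets is an inequality between measures and so passes to integrals of
  nonnegative functions. The bound \<open>c\<close> provides integrability, which allows the return
  to Bochner integrals.\<close>

lemma kernel_integral_ge:
  fixes f :: "'x \<Rightarrow> real"
  assumes \<zeta>: "\<zeta> \<in> space MZ" "x \<in> space N" and f: "f \<in> borel_measurable N"
    and bound: "\<And>y. y \<in> space N \<Longrightarrow> 0 \<le> f y \<and> f y \<le> c"
  shows "\<beta> * (\<integral>y. f y \<partial>\<pi>) \<le> (\<integral>y. f y \<partial>\<kappa> \<zeta> x)"
proof -
  note ks = kernel_sets[OF \<zeta>]
  have int: "integrable \<pi> f" "integrable (\<kappa> \<zeta> x) f"
    using bound by (auto intro!: integrable_bounded[of _ f c] target_sets ks f)
  have nn: "AE y in \<pi>. 0 \<le> f y" "AE y in \<kappa> \<zeta> x. 0 \<le> f y"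
    using bound by (auto intro!: AE_I2 simp: ks target_sets)
  have "scale_measure (ennreal \<beta>) \<pi> \<le> \<kappa> \<zeta> x"
    using minorization[OF \<zeta>] ks target_sets
    by (subst le_measure) auto
  then have "(\<integral>\<^sup>+y. f y \<partial>scale_measure (ennreal \<beta>) \<pi>) \<le> (\<integral>\<^sup>+y. f y \<partial>\<kappa> \<zeta> x)"
    by (intro nn_integral_mono_measure) (auto simp: ks target_sets)
  then have "ennreal \<beta> * (\<integral>\<^sup>+y. f y \<partial>\<pi>) \<le> (\<integral>\<^sup>+y. f y \<partial>\<kappa> \<zeta> x)"
    using f target_sets by (subst (asm) nn_integral_scale_measure) (auto cong: measurable_cong_sets)
  then have "ennreal (\<beta> * (\<integral>y. f y \<partial>\<pi>)) \<le> ennreal (\<integral>y. f y \<partial>\<kappa> \<zeta> x)"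
    using int nn \<beta> by (simp add: nn_integral_eq_integral ennreal_mult' integral_nonneg_AE)
  then show ?thesis
    using nn by (simp add: integral_nonneg_AE ennreal_le_iff)
qed

text \<open>The minorization is applied to the nonnegative functions \<open>c + f\<close> and \<open>c - f\<close>.\<close>

lemma kernel_contraction:
  fixes f :: "'x \<Rightarrow> real"
  assumes \<zeta>: "\<zeta> \<in> space MZ" "x \<in> space N" and f [measurable]: "f \<in> borel_measurable N"
    and bound: "\<And>y. y \<in> space N \<Longrightarrow> \<bar>f y\<bar> \<le> c" and centred: "(\<integral>y. f y \<partial>\<pi>) = 0"
  shows "\<bar>\<integral>y. f y \<partial>\<kappa> \<zeta> x\<bar> \<le> (1 - \<beta>) * c"
proof -
  note ks = kernel_sets[OF \<zeta>]
  interpret \<pi>: prob_space \<pi> by (rule target_sets)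
  interpret K: prob_space "\<kappa> \<zeta> x" by (rule ks)
  have int: "integrable \<pi> f" "integrable (\<kappa> \<zeta> x) f"
    using bound by (auto intro!: integrable_bounded[of _ f c] target_sets ks f)
  have range: "0 \<le> c + f y \<and> c + f y \<le> 2 * c" "0 \<le> c - f y \<and> c - f y \<le> 2 * c"
    if "y \<in> space N" for y
    using bound[OF that] by (auto simp: abs_le_iff)
  have "\<beta> * (\<integral>y. c + f y \<partial>\<pi>) \<le> (\<integral>y. c + f y \<partial>\<kappa> \<zeta> x)"
    using range by (intro kernel_integral_ge[OF \<zeta>, of _ "2 * c"]) auto
  moreover have "\<beta> * (\<integral>y. c - f y \<partial>\<pi>) \<le> (\<integral>y. c - f y \<partial>\<kappa> \<zeta> x)"
    using range by (intro kernel_integral_ge[OF \<zeta>, of _ "2 * c"]) auto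
  ultimately show ?thesis
    using int centred by (simp add: \<pi>.prob_space K.prob_space algebra_simps abs_le_iff)
qed

text \<open>Invariance on sets says that \<open>\<pi> \<bind> \<kappa> \<zeta>\<close> is
  \<open>\<pi>\<close>; integrating \<open>f\<close> against both gives the claim.\<close>

lemma integral_invariant:
  fixes f :: "'x \<Rightarrow> real"
  assumes \<zeta>: "\<zeta> \<in> space MZ" and f: "f \<in> borel_measurable N" and bound: "\<And>y. y \<in> space N \<Longrightarrow> \<bar>f y\<bar> \<le> c"
  shows "(\<integral>x. (\<integral>y. f y \<partial>\<kappa> \<zeta> x) \<partial>\<pi>) = (\<integral>y. f y \<partial>\<pi>)"
proof -
  interpret \<pi>: prob_space \<pi> by (rule target_sets)
  have k: "\<kappa> \<zeta> \<in> \<pi> \<rightarrow>\<^sub>M subprob_algebra N"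
    using measurable_prob_algebraD[OF measurable_Pair2[OF kernel \<zeta>]] target_sets
    by (simp cong: measurable_cong_sets)
  have "\<pi> \<bind> \<kappa> \<zeta> = \<pi>"
  proof (rule measure_eqI)
    show "sets (\<pi> \<bind> \<kappa> \<zeta>) = sets \<pi>"
      using sets_bind[OF _ \<pi>.not_empty, of "\<kappa> \<zeta>" N] kernel_sets[OF \<zeta>] target_sets by auto
    then show "emeasure (\<pi> \<bind> \<kappa> \<zeta>) A = emeasure \<pi> A" if "A \<in> sets (\<pi> \<bind> \<kappa> \<zeta>)" for A
      using that target_sets invariant[OF \<zeta>] by (subst emeasure_bind[OF \<pi>.not_empty k]) auto
  qed
  moreover have "integral\<^sup>L (\<pi> \<bind> \<kappa> \<zeta>) f = (\<integral>x. (\<integral>y. f y \<partial>\<kappa> \<zeta> x) \<partial>\<pi>)"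
  proof (rule integral_bind[where B = c and B' = 1, OF f _ k])
    show "finite_measure \<pi>" by (rule \<pi>.finite_measure_axioms)
    show "AE x in \<pi>. emeasure (\<kappa> \<zeta> x) (space (\<kappa> \<zeta> x)) \<le> ennreal 1"
      using kernel_sets(3)[OF \<zeta>] target_sets by (auto intro!: AE_I2 simp: prob_space.emeasure_space_1)
  qed (use bound in auto)
  ultimately show ?thesis by simp
qed

section \<open>Solution of the Poisson equation\<close>

definition kernel_step :: "('z \<Rightarrow> 'x \<Rightarrow> real) \<Rightarrow> 'z \<Rightarrow> 'x \<Rightarrow> real" where
  "kernel_step f \<zeta> x = (\<integral>y. f \<zeta> y \<partial>\<kappa> \<zeta> x)"

text \<open>Measurability must be joint, because the Poisson solution is later evaluated at the
  random pair of \<open>Z j\<close> and \<open>X j\<close>. For this reason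
  \<open>kernel_step\<close> acts on functions of parameter and state.\<close>

lemma kernel_step_measurable:
  assumes "(\<lambda>(\<zeta>, x). f \<zeta> x) \<in> borel_measurable (MZ \<Otimes>\<^sub>M N)"
  shows "(\<lambda>(\<zeta>, x). kernel_step f \<zeta> x) \<in> borel_measurable (MZ \<Otimes>\<^sub>M N)"
proof -
  have "(\<lambda>p. integral\<^sup>L ((\<lambda>(\<zeta>, x). \<kappa> \<zeta> x) p) (f (fst p))) \<in> borel_measurable (MZ \<Otimes>\<^sub>M N)"
  proof (rule integral_measurable_subprob_algebra2[OF _ measurable_prob_algebraD[OF kernel]])
    have "(\<lambda>p. (fst (fst p), snd p)) \<in> (MZ \<Otimes>\<^sub>M N) \<Otimes>\<^sub>M N \<rightarrow>\<^sub>M MZ \<Otimes>\<^sub>M N"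
      by measurable
    from measurable_compose[OF this assms]
    show "(\<lambda>(p, y). f (fst p) y) \<in> borel_measurable ((MZ \<Otimes>\<^sub>M N) \<Otimes>\<^sub>M N)"
      by (simp add: case_prod_beta)
  qed
  then show ?thesis
    by (simp add: kernel_step_def case_prod_beta)
qed

definition centred_iterate :: "('x \<Rightarrow> real) \<Rightarrow> nat \<Rightarrow> 'z \<Rightarrow> 'x \<Rightarrow> real" where
  "centred_iterate h k = (kernel_step ^^ k) (\<lambda>\<zeta> x. h x - (\<integral>y. h y \<partial>\<pi>))"

lemma centred_iterate_simps [simp]:
  "centred_iterate h 0 \<zeta> x = h x - (\<integral>y. h y \<partial>\<pi>)"
  "centred_iterate h (Suc k) \<zeta> x = (\<integral>y. centred_iterate h k \<zeta> y \<partial>\<kappa> \<zeta> x)"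
  by (simp_all add: centred_iterate_def kernel_step_def)

definition poisson :: "('x \<Rightarrow> real) \<Rightarrow> 'z \<Rightarrow> 'x \<Rightarrow> real" where
  "poisson h \<zeta> x = (\<Sum>k. centred_iterate h k \<zeta> x)"

text \<open>The deviation of the Poisson solution at the new state from its conditional mean given
  the past. The paths are arguments so that the same formula can be read on the history space and
  along an outcome.\<close>

definition increment :: "('x \<Rightarrow> real) \<Rightarrow> nat \<Rightarrow> (nat \<Rightarrow> 'x) \<Rightarrow> (nat \<Rightarrow> 'z) \<Rightarrow> real" where
  "increment h j xs zs = poisson h (zs j) (xs (Suc j)) - kernel_step (poisson h) (zs j) (xs j)"

abbreviation "histories n \<equiv> PiM {..n::nat} (\<lambda>_. N) \<Otimes>\<^sub>M PiM {..n} (\<lambda>_. MZ)"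

abbreviation "history n \<omega> \<equiv> (\<lambda>i\<in>{..n}. X i \<omega>, \<lambda>i\<in>{..n}. Z i \<omega>)"

context
  fixes h :: "'x \<Rightarrow> real" and B :: real
  assumes h [measurable]: "h \<in> borel_measurable N" and hB: "\<And>x. x \<in> space N \<Longrightarrow> \<bar>h x\<bar> \<le> B"
begin

lemma centred_iterate_measurable:
  "(\<lambda>(\<zeta>, x). centred_iterate h k \<zeta> x) \<in> borel_measurable (MZ \<Otimes>\<^sub>M N)"
proof (induction k)
  case 0
  show ?case by simp
next
  case (Suc k)
  then show ?case
    using kernel_step_measurable[OF Suc] by (simp add: kernel_step_def)
qed

text \<open>Both claims go through one induction: the contraction needs the mean to be zero, and
  invariance keeps it zero.\<close>

lemma centred_iterate_bound:
  assumes \<zeta>: "\<zeta> \<in> space MZ"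
  shows "(\<forall>x\<in>space N. \<bar>centred_iterate h k \<zeta> x\<bar> \<le> (1 - \<beta>) ^ k * (2 * B)) \<and>
    (\<integral>x. centred_iterate h k \<zeta> x \<partial>\<pi>) = 0"
proof (induction k)
  case 0
  interpret \<pi>: prob_space \<pi> by (rule target_sets)
  \<comment> \<open>The initial constant \<open>2 * B\<close> bounds \<open>h\<close> minus its
    mean.\<close>
  have "\<bar>\<integral>y. h y \<partial>\<pi>\<bar> \<le> B"
    using hB by (intro integral_abs_le target_sets h)
  moreover have "integrable \<pi> h"
    using hB by (intro integrable_bounded target_sets h)
  ultimately show ?case
    using hB by (auto simp: \<pi>.prob_space abs_le_iff intro: order_trans) (smt (verit) hB)+
next
  case (Suc k)
  have m: "centred_iterate h k \<zeta> \<in> borel_measurable N"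
    by (rule section_measurable[OF centred_iterate_measurable \<zeta>])
  show ?case
  proof
    show "\<forall>x\<in>space N. \<bar>centred_iterate h (Suc k) \<zeta> x\<bar> \<le> (1 - \<beta>) ^ Suc k * (2 * B)"
      using kernel_contraction[OF \<zeta> _ m] Suc by (simp add: mult.assoc)
    show "(\<integral>x. centred_iterate h (Suc k) \<zeta> x \<partial>\<pi>) = 0"
      using integral_invariant[OF \<zeta> m, of "(1 - \<beta>) ^ k * (2 * B)"] Suc by simp
  qed
qed

lemma geometric: "summable (\<lambda>k. (1 - \<beta>) ^ k * (2 * B))" "(\<Sum>k. (1 - \<beta>) ^ k * (2 * B)) = 2 * B / \<beta>"
  using \<beta> suminf_geometric[of "1 - \<beta>"] suminf_mult2[OF summable_geometric[of "1 - \<beta>"], of "2 * B"]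
  by (auto intro!: summable_mult2 summable_geometric)

lemma centred_iterate_summable:
  assumes "\<zeta> \<in> space MZ" "x \<in> space N"
  shows "summable (\<lambda>k. \<bar>centred_iterate h k \<zeta> x\<bar>)"
  using centred_iterate_bound[OF assms(1)] assms(2)
  by (intro summable_comparison_test'[OF geometric(1), of 0]) auto

lemma poisson_bound:
  assumes "\<zeta> \<in> space MZ" "x \<in> space N"
  shows "\<bar>poisson h \<zeta> x\<bar> \<le> 2 * B / \<beta>"
proof -
  have "\<bar>poisson h \<zeta> x\<bar> \<le> (\<Sum>k. \<bar>centred_iterate h k \<zeta> x\<bar>)"
    unfolding poisson_def by (rule summable_rabs[OF centred_iterate_summable[OF assms]])
  also have "\<dots> \<le> (\<Sum>k. (1 - \<beta>) ^ k * (2 * B))"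
    using centred_iterate_bound[OF assms(1)] assms(2)
    by (intro suminf_le centred_iterate_summable[OF assms] geometric) auto
  finally show ?thesis by (simp add: geometric)
qed

lemma poisson_measurable: "(\<lambda>(\<zeta>, x). poisson h \<zeta> x) \<in> borel_measurable (MZ \<Otimes>\<^sub>M N)"
  using centred_iterate_measurable unfolding poisson_def case_prod_beta
  by (intro borel_measurable_suminf)

text \<open>Applying the kernel shifts the series by one index, so only the zeroth term survives in
  the difference. The geometric bound justifies integrating term by term.\<close>

lemma poisson_equation:
  assumes \<zeta>: "\<zeta> \<in> space MZ" "x \<in> space N"
  shows "poisson h \<zeta> x - kernel_step (poisson h) \<zeta> x = h x - (\<integral>y. h y \<partial>\<pi>)"
proof -
  note ks = kernel_sets[OF \<zeta>]
  have m: "centred_iterate h k \<zeta> \<in> borel_measurable N" for k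
    by (rule section_measurable[OF centred_iterate_measurable \<zeta>(1)])
  have b: "\<bar>centred_iterate h k \<zeta> y\<bar> \<le> (1 - \<beta>) ^ k * (2 * B)" if "y \<in> space N" for k y
    using centred_iterate_bound[OF \<zeta>(1)] that by blast
  have "kernel_step (poisson h) \<zeta> x = (\<Sum>k. \<integral>y. centred_iterate h k \<zeta> y \<partial>\<kappa> \<zeta> x)"
    unfolding kernel_step_def poisson_def
  proof (rule integral_suminf)
    show "integrable (\<kappa> \<zeta> x) (centred_iterate h k \<zeta>)" for k
      by (rule integrable_bounded[OF ks(1,3) m b])
    show "AE y in \<kappa> \<zeta> x. summable (\<lambda>k. norm (centred_iterate h k \<zeta> y))"
      using centred_iterate_summable[OF \<zeta>(1)] ks by (auto intro!: AE_I2)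
    have "\<bar>\<integral>y. \<bar>centred_iterate h k \<zeta> y\<bar> \<partial>\<kappa> \<zeta> x\<bar> \<le> (1 - \<beta>) ^ k * (2 * B)" for k
      using m[of k] b by (intro integral_abs_le ks) auto
    then show "summable (\<lambda>k. \<integral>y. norm (centred_iterate h k \<zeta> y) \<partial>\<kappa> \<zeta> x)"
      by (intro summable_comparison_test'[OF geometric(1), of 0]) auto
  qed
  also have "\<dots> = (\<Sum>k. centred_iterate h (Suc k) \<zeta> x)"
    by simp
  also have "\<dots> = poisson h \<zeta> x - centred_iterate h 0 \<zeta> x"
    unfolding poisson_def
    by (rule suminf_split_head[OF summable_rabs_cancel[OF centred_iterate_summable[OF \<zeta>]]])
  finally show ?thesis by simp
qed

lemma kernel_step_poisson_bound:
  assumes "\<zeta> \<in> space MZ" "x \<in> space N"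
  shows "\<bar>kernel_step (poisson h) \<zeta> x\<bar> \<le> 2 * B / \<beta>"
  unfolding kernel_step_def using assms
  by (intro integral_abs_le kernel_sets poisson_bound section_measurable[OF poisson_measurable])

section \<open>Martingale differences and telescoping remainder\<close>

lemma martingale_difference_bound:
  assumes "\<zeta> \<in> space MZ" "x \<in> space N" "y \<in> space N"
  shows "\<bar>poisson h \<zeta> y - kernel_step (poisson h) \<zeta> x\<bar> \<le> 4 * B / \<beta>"
proof -
  have "4 * B / \<beta> = 2 * B / \<beta> + 2 * B / \<beta>"
    by simp
  then show ?thesis
    using poisson_bound[OF assms(1,3)] kernel_step_poisson_bound[OF assms(1,2)] by linarith
qed

lemma increment_bound: "\<omega> \<in> space M \<Longrightarrow> \<bar>increment h j (\<lambda>i. X i \<omega>) (\<lambda>i. Z i \<omega>)\<bar> \<le> 4 * B / \<beta>"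
  unfolding increment_def by (intro martingale_difference_bound) (auto intro: measurable_space)

lemma increment_measurable:
  assumes "Suc j \<le> n"
  shows "(\<lambda>p. increment h j (fst p) (snd p)) \<in> borel_measurable (histories n)"
proof -
  have 1: "(\<lambda>p. (snd p j, fst p (Suc j))) \<in> histories n \<rightarrow>\<^sub>M MZ \<Otimes>\<^sub>M N"
    and 2: "(\<lambda>p. (snd p j, fst p j)) \<in> histories n \<rightarrow>\<^sub>M MZ \<Otimes>\<^sub>M N"
    using assms by (auto intro!: measurable_Pair measurable_compose[OF measurable_fst]
        measurable_compose[OF measurable_snd] measurable_component_singleton)
  show ?thesis
    using measurable_compose[OF 1 poisson_measurable]
      measurable_compose[OF 2 kernel_step_measurable[OF poisson_measurable]]
    unfolding increment_def by simp
qed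

text \<open>Given the history up to \<open>n\<close>, the next state has law
  \<open>\<kappa> (Z n \<omega>) (X n \<omega>)\<close>, under which the increment has mean zero. A
  bounded function of that history can be pulled out of the conditional mean.\<close>

lemma increment_orthogonal:
  assumes W: "W \<in> borel_measurable (histories n)"
    and c: "\<And>p. p \<in> space (histories n) \<Longrightarrow> \<bar>W p\<bar> \<le> c"
  shows "(\<integral>\<omega>. W (history n \<omega>) * increment h n (\<lambda>i. X i \<omega>) (\<lambda>i. Z i \<omega>) \<partial>M) = 0"
proof -
  \<comment> \<open>The history \<open>p\<close> is separated from the new state \<open>y\<close>,
    the only variable integrated in the inner stage.\<close>
  let ?f = "\<lambda>(p, y). W p * (poisson h (snd p n) y - kernel_step (poisson h) (snd p n) (fst p n))"
  have sp: "snd p n \<in> space MZ" "fst p n \<in> space N" if "p \<in> space (histories n)" for p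
    using that by (auto simp: space_pair_measure space_PiM PiE_def Pi_def)
  have hist: "history n \<omega> \<in> space (histories n)" if "\<omega> \<in> space M" for \<omega>
    using that measurable_space[OF X_measurable that] measurable_space[OF Z_measurable that]
    by (auto simp: space_pair_measure space_PiM)
  have 1: "(\<lambda>q. (snd (fst q) n, snd q)) \<in> histories n \<Otimes>\<^sub>M N \<rightarrow>\<^sub>M MZ \<Otimes>\<^sub>M N"
    and 2: "(\<lambda>q. (snd (fst q) n, fst (fst q) n)) \<in> histories n \<Otimes>\<^sub>M N \<rightarrow>\<^sub>M MZ \<Otimes>\<^sub>M N"
    by (auto intro!: measurable_Pair measurable_compose[OF measurable_compose[OF measurable_fst measurable_fst]]
        measurable_compose[OF measurable_compose[OF measurable_fst measurable_snd]] measurable_component_singleton)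
  have "(\<integral>\<omega>. ?f (history n \<omega>, X (Suc n) \<omega>) \<partial>M)
      = (\<integral>\<omega>. (\<integral>y. ?f (history n \<omega>, y) \<partial>(\<lambda>(xs, zs). \<kappa> (zs n) (xs n)) (history n \<omega>)) \<partial>M)"
  proof (rule drawn_from_expectation[OF prob_space_axioms transition, where B = "c * (4 * B / \<beta>)"])
    show "?f \<in> borel_measurable (histories n \<Otimes>\<^sub>M N)"
      using measurable_compose[OF measurable_fst W] measurable_compose[OF 1 poisson_measurable]
        measurable_compose[OF 2 kernel_step_measurable[OF poisson_measurable]]
      unfolding case_prod_beta
      by (intro borel_measurable_times borel_measurable_diff) simp_all
  next
    fix p y assume p: "p \<in> space (histories n)" and y: "y \<in> space N"
    have "\<bar>poisson h (snd p n) y - kernel_step (poisson h) (snd p n) (fst p n)\<bar> \<le> 4 * B / \<beta>"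
      by (intro martingale_difference_bound sp p y)
    then show "\<bar>?f (p, y)\<bar> \<le> c * (4 * B / \<beta>)"
      using c[OF p] unfolding prod.case abs_mult by (intro mult_mono') auto
  qed
  also have "\<dots> = (\<integral>\<omega>. 0 \<partial>M)"
  proof (rule Bochner_Integration.integral_cong[OF refl])
    fix \<omega> assume \<omega>: "\<omega> \<in> space M"
    have \<zeta>: "Z n \<omega> \<in> space MZ" "X n \<omega> \<in> space N"
      using \<omega> by (auto intro: measurable_space)
    interpret K: prob_space "\<kappa> (Z n \<omega>) (X n \<omega>)" by (rule kernel_sets[OF \<zeta>])
    have "integrable (\<kappa> (Z n \<omega>) (X n \<omega>)) (poisson h (Z n \<omega>))"
      by (intro integrable_bounded[OF kernel_sets(1,3)[OF \<zeta>] section_measurable[OF poisson_measurable] poisson_bound] \<zeta>)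
    then show "(\<integral>y. ?f (history n \<omega>, y) \<partial>(\<lambda>(xs, zs). \<kappa> (zs n) (xs n)) (history n \<omega>)) = 0"
      by (simp add: K.prob_space kernel_step_def)
  qed
  finally show ?thesis
    by (simp add: increment_def)
qed

text \<open>Squaring the sum produces cross terms that vanish by orthogonality, so each increment
  contributes at most the square of its uniform bound.\<close>

lemma increment_sum_second_moment:
  "(\<integral>\<omega>. (\<Sum>j=1..n. increment h j (\<lambda>i. X i \<omega>) (\<lambda>i. Z i \<omega>))\<^sup>2 \<partial>M) \<le> n * (4 * B / \<beta>)\<^sup>2"
proof (induction n)
  case 0
  show ?case by simp
next
  case (Suc n)
  let ?D = "\<lambda>j \<omega>. increment h j (\<lambda>i. X i \<omega>) (\<lambda>i. Z i \<omega>)"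
  let ?S = "\<lambda>\<omega>. \<Sum>j=1..n. ?D j \<omega>"
  \<comment> \<open>Increment \<open>j\<close> looks ahead to state \<open>Suc j\<close>. The sum up
    to \<open>n\<close> is thus a function of the history up to \<open>Suc n\<close>, exactly the
    past on which increment \<open>Suc n\<close> is conditioned.\<close>
  let ?W = "\<lambda>p. \<Sum>j=1..n. increment h j (fst p) (snd p)"
  let ?G = "4 * B / \<beta>"
  have hist [measurable]: "history m \<in> M \<rightarrow>\<^sub>M histories m" for m
    using transition[of m] by (simp add: drawn_from_def)
  have D_hist: "increment h j (fst (history m \<omega>)) (snd (history m \<omega>)) = ?D j \<omega>" if "Suc j \<le> m" for j m \<omega>
    using that by (simp add: increment_def)
  have S_hist: "?W (history (Suc n) \<omega>) = ?S \<omega>" for \<omega>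
    by (intro sum.cong refl D_hist) auto
  have W: "?W \<in> borel_measurable (histories (Suc n))"
    by (intro borel_measurable_sum increment_measurable) auto
  have D [measurable]: "?D j \<in> borel_measurable M" for j
    using measurable_compose[OF hist increment_measurable[of j "Suc j"]] D_hist[of j "Suc j"] by simp
  \<comment> \<open>\<open>increment_orthogonal\<close> asks for a bound on the whole history space,
    not merely along trajectories.\<close>
  have Wb: "\<bar>?W p\<bar> \<le> n * ?G" if p: "p \<in> space (histories (Suc n))" for p
  proof -
    have sp: "snd p j \<in> space MZ" "fst p j \<in> space N" if "j \<le> Suc n" for j
      using p that by (auto simp: space_pair_measure space_PiM PiE_def Pi_def)
    have "\<bar>increment h j (fst p) (snd p)\<bar> \<le> ?G" if "j \<in> {1..n}" for j
      unfolding increment_def using that by (intro martingale_difference_bound sp) auto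
    then have "(\<Sum>j=1..n. \<bar>increment h j (fst p) (snd p)\<bar>) \<le> (\<Sum>j=1..n. ?G)"
      by (rule sum_mono)
    then show ?thesis
      by (intro order_trans[OF sum_abs]) simp
  qed
  have Sb: "\<bar>?S \<omega>\<bar> \<le> n * ?G" if "\<omega> \<in> space M" for \<omega>
    using Wb[OF measurable_space[OF hist that]] S_hist by simp
  have int: "integrable M (\<lambda>\<omega>. (?S \<omega>)\<^sup>2)" "integrable M (\<lambda>\<omega>. (?D (Suc n) \<omega>)\<^sup>2)"
      "integrable M (\<lambda>\<omega>. ?S \<omega> * ?D (Suc n) \<omega>)"
    subgoal
      using Sb by (intro integrable_const_bound[of _ "(n * ?G)\<^sup>2"])
        (auto intro!: AE_I2 abs_le_square_iff[THEN iffD1] intro: order_trans[OF _ abs_ge_self])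
    subgoal
      using increment_bound by (intro integrable_const_bound[of _ "?G\<^sup>2"])
        (auto intro!: AE_I2 abs_le_square_iff[THEN iffD1] intro: order_trans[OF _ abs_ge_self])
    subgoal
    proof (rule integrable_const_bound[of _ "n * ?G * ?G"])
      show "AE \<omega> in M. norm (?S \<omega> * ?D (Suc n) \<omega>) \<le> n * ?G * ?G"
        unfolding real_norm_def abs_mult
        by (intro AE_I2 mult_mono' Sb increment_bound) auto
    qed measurable
    done
  have "(\<integral>\<omega>. (\<Sum>j=1..Suc n. ?D j \<omega>)\<^sup>2 \<partial>M)
      = (\<integral>\<omega>. (?S \<omega>)\<^sup>2 + (2 * (?S \<omega> * ?D (Suc n) \<omega>) + (?D (Suc n) \<omega>)\<^sup>2) \<partial>M)"
    by (intro Bochner_Integration.integral_cong refl) (simp add: power2_sum algebra_simps)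
  also have "\<dots> = (\<integral>\<omega>. (?S \<omega>)\<^sup>2 \<partial>M) + (2 * (\<integral>\<omega>. ?S \<omega> * ?D (Suc n) \<omega> \<partial>M) + (\<integral>\<omega>. (?D (Suc n) \<omega>)\<^sup>2 \<partial>M))"
    using int by simp
  also have "(\<integral>\<omega>. ?S \<omega> * ?D (Suc n) \<omega> \<partial>M) = 0"
    using increment_orthogonal[OF W Wb] unfolding S_hist by simp
  also have "(\<integral>\<omega>. (?D (Suc n) \<omega>)\<^sup>2 \<partial>M) \<le> ?G\<^sup>2"
    using increment_bound
    by (intro integral_le_const int) (auto intro!: AE_I2 abs_le_square_iff[THEN iffD1] order_trans[OF _ abs_ge_self])
  finally show ?case
    using Suc by (simp add: algebra_simps)
qed

text \<open>With the end term added, passing from \<open>n\<close> to \<open>Suc n\<close> changes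
  the expression only by the difference of the Poisson solutions for \<open>Z (Suc n)\<close> and
  \<open>Z n\<close> at the same state \<open>X (Suc n)\<close>. This difference vanishes unless
  \<open>Suc n\<close> is an adaptation time.\<close>

lemma remainder_bound:
  "AE \<omega> in M. \<forall>n. \<bar>(\<Sum>j=1..n. poisson h (Z j \<omega>) (X j \<omega>) - poisson h (Z j \<omega>) (X (Suc j) \<omega>))
        + poisson h (Z n \<omega>) (X (Suc n) \<omega>)\<bar>
      \<le> 2 * B / \<beta> * (1 + 2 * card {j \<in> {1..n}. adaptation_time j})"
proof -
  \<comment> \<open>Countably many exceptional null sets are merged, so that the induction can run
    along a fixed outcome.\<close>
  have "AE \<omega> in M. \<forall>n\<in>{n. n \<ge> 1 \<and> \<not> adaptation_time n}. Z n \<omega> = Z (n - 1) \<omega>"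
    using Z_constant by (subst AE_ball_countable) auto
  then show ?thesis
  proof (rule AE_mp[OF _ AE_I2], intro impI allI)
    fix \<omega> n assume \<omega>: "\<omega> \<in> space M"
      and Zc: "\<forall>n\<in>{n. n \<ge> 1 \<and> \<not> adaptation_time n}. Z n \<omega> = Z (n - 1) \<omega>"
    have b: "\<bar>poisson h (Z i \<omega>) (X j \<omega>)\<bar> \<le> 2 * B / \<beta>" for i j
      using \<omega> by (intro poisson_bound) (auto intro: measurable_space)
    let ?P = "\<lambda>n. (\<Sum>j=1..n. poisson h (Z j \<omega>) (X j \<omega>) - poisson h (Z j \<omega>) (X (Suc j) \<omega>))
        + poisson h (Z n \<omega>) (X (Suc n) \<omega>)"
    show "\<bar>?P n\<bar> \<le> 2 * B / \<beta> * (1 + 2 * card {j \<in> {1..n}. adaptation_time j})"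
    proof (induction n)
      case 0
      \<comment> \<open>The sum is empty, and the end term accounts for the summand 1 in the
        bound.\<close>
      show ?case using b[of 0 1] by simp
    next
      case (Suc n)
      let ?d = "poisson h (Z (Suc n) \<omega>) (X (Suc n) \<omega>) - poisson h (Z n \<omega>) (X (Suc n) \<omega>)"
      have P: "?P (Suc n) = ?P n + ?d"
        by simp
      show ?case
      proof (cases "adaptation_time (Suc n)")
        case True
        then have "{j \<in> {1..Suc n}. adaptation_time j} = insert (Suc n) {j \<in> {1..n}. adaptation_time j}"
          by (auto simp: le_Suc_eq)
        then have card: "card {j \<in> {1..Suc n}. adaptation_time j} = Suc (card {j \<in> {1..n}. adaptation_time j})"
          by simp
        have d: "\<bar>?d\<bar> \<le> 2 * B / \<beta> * 2"
          using b[of "Suc n" "Suc n"] b[of n "Suc n"] by linarith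
        have "\<bar>?P n + ?d\<bar> \<le> \<bar>?P n\<bar> + \<bar>?d\<bar>"
          by (rule abs_triangle_ineq)
        also have "\<dots> \<le> 2 * B / \<beta> * (1 + 2 * card {j \<in> {1..n}. adaptation_time j}) + 2 * B / \<beta> * 2"
          by (rule add_mono[OF Suc d])
        also have "\<dots> = 2 * B / \<beta> * (1 + 2 * Suc (card {j \<in> {1..n}. adaptation_time j}))"
          unfolding distrib_left[symmetric] by simp
        finally show ?thesis
          unfolding P card .
      next
        case False
        then have "{j \<in> {1..Suc n}. adaptation_time j} = {j \<in> {1..n}. adaptation_time j}"
          by (auto simp: le_Suc_eq)
        moreover have "?d = 0"
          using Zc False by auto
        ultimately show ?thesis
          unfolding P using Suc by simp
      qed
    qed
  qed
qed

section \<open>Combination of both sums into the mean square bound\<close>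

lemma mean_square_error:
  assumes "n \<ge> 1"
  shows "(\<integral>\<omega>. \<bar>(1 / real n) * (\<Sum>j=1..n. h (X j \<omega>)) - (\<integral>x. h x \<partial>\<pi>)\<bar>\<^sup>2 \<partial>M) \<le> 224 / \<beta>\<^sup>2 * B\<^sup>2 / n"
proof -
  let ?D = "\<lambda>j \<omega>. increment h j (\<lambda>i. X i \<omega>) (\<lambda>i. Z i \<omega>)"
  let ?S = "\<lambda>\<omega>. \<Sum>j=1..n. ?D j \<omega>"
  let ?E = "\<lambda>\<omega>. (1 / real n) * (\<Sum>j=1..n. h (X j \<omega>)) - (\<integral>x. h x \<partial>\<pi>)"
  let ?R = "\<lambda>\<omega>. \<Sum>j=1..n. poisson h (Z j \<omega>) (X j \<omega>) - poisson h (Z j \<omega>) (X (Suc j) \<omega>)"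
  define G where "G = 2 * B / \<beta>"
  define a where "a = real (card {j \<in> {1..n}. adaptation_time j})"
  have a: "a\<^sup>2 \<le> 2 * n"
    using card_adaptation_times_le[of n] unfolding a_def
    by (metis of_nat_le_iff of_nat_mult of_nat_numeral of_nat_power)
  \<comment> \<open>Here \<open>a\<close> counts the adaptation times, and
    \<open>2 * (1 + 2 * n) \<le> 6 * n\<close> because \<open>n \<ge> 1\<close>.\<close>
  have "(1 + a)\<^sup>2 \<le> 2 * (1 + a\<^sup>2)"
    using zero_le_power2[of "1 - a"] by (simp add: power2_eq_square algebra_simps)
  also have "\<dots> \<le> 6 * n"
    using a assms by (simp add: algebra_simps)
  finally have a_sq: "(1 + a)\<^sup>2 \<le> 6 * n" .
  have hist: "history m \<in> M \<rightarrow>\<^sub>M histories m" for m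
    using transition[of m] by (simp add: drawn_from_def)
  have D [measurable]: "?D j \<in> borel_measurable M" for j
    using measurable_compose[OF hist increment_measurable[of j "Suc j"]] by (simp add: increment_def)
  have split: "real n * ?E \<omega> = ?S \<omega> + ?R \<omega>" if \<omega>: "\<omega> \<in> space M" for \<omega>
  proof -
    have "h (X j \<omega>) - (\<integral>x. h x \<partial>\<pi>)
        = ?D j \<omega> + (poisson h (Z j \<omega>) (X j \<omega>) - poisson h (Z j \<omega>) (X (Suc j) \<omega>))" for j
      using poisson_equation[OF measurable_space[OF Z_measurable \<omega>] measurable_space[OF X_measurable \<omega>]]
      by (simp add: increment_def)
    then have "(\<Sum>j=1..n. h (X j \<omega>) - (\<integral>x. h x \<partial>\<pi>)) = ?S \<omega> + ?R \<omega>"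
      by (simp add: sum.distrib)
    then show ?thesis
      using assms by (simp add: sum_subtractf right_diff_distrib)
  qed
  have rescale: "n\<^sup>2 * e \<le> 2 * t \<Longrightarrow> e \<le> (2 / n\<^sup>2) * t" for e t :: real
    using assms by (simp add: field_simps)
  have bound: "AE \<omega> in M. (?E \<omega>)\<^sup>2 \<le> (2 / n\<^sup>2) * ((?S \<omega>)\<^sup>2 + 24 * G\<^sup>2 * n)"
    using remainder_bound
  proof (rule AE_mp[OF _ AE_I2], intro impI)
    fix \<omega> assume \<omega>: "\<omega> \<in> space M" and r: "\<forall>n. \<bar>(\<Sum>j=1..n. poisson h (Z j \<omega>) (X j \<omega>) - poisson h (Z j \<omega>) (X (Suc j) \<omega>))
        + poisson h (Z n \<omega>) (X (Suc n) \<omega>)\<bar>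
      \<le> 2 * B / \<beta> * (1 + 2 * card {j \<in> {1..n}. adaptation_time j})"
    \<comment> \<open>The end term added in \<open>remainder_bound\<close> is removed again at the
      cost of one more \<open>G\<close>.\<close>
    have "\<bar>poisson h (Z n \<omega>) (X (Suc n) \<omega>)\<bar> \<le> G"
      unfolding G_def using \<omega> by (intro poisson_bound) (auto intro: measurable_space)
    moreover have "\<bar>?R \<omega> + poisson h (Z n \<omega>) (X (Suc n) \<omega>)\<bar> \<le> G * (1 + 2 * a)"
      using r[rule_format, of n] unfolding G_def a_def by simp
    moreover have "2 * G * (1 + a) = G * (1 + 2 * a) + G"
      by (simp add: algebra_simps)
    ultimately have "\<bar>?R \<omega>\<bar> \<le> 2 * G * (1 + a)"
      by linarith
    then have "(?R \<omega>)\<^sup>2 \<le> (2 * G * (1 + a))\<^sup>2"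
      using abs_le_square_iff order_trans[OF _ abs_ge_self] by blast
    also have "\<dots> = 4 * G\<^sup>2 * (1 + a)\<^sup>2"
      by (simp add: power_mult_distrib)
    \<comment> \<open>The factors 4 and 6 produce the constant 24.\<close>
    also have "\<dots> \<le> 4 * G\<^sup>2 * (6 * n)"
      using a_sq by (rule mult_left_mono) simp
    finally have R: "(?R \<omega>)\<^sup>2 \<le> 24 * G\<^sup>2 * n"
      by simp
    have "n\<^sup>2 * (?E \<omega>)\<^sup>2 = (?S \<omega> + ?R \<omega>)\<^sup>2"
      unfolding split[OF \<omega>, symmetric] by (simp add: power_mult_distrib)
    also have "\<dots> \<le> 2 * ((?S \<omega>)\<^sup>2 + (?R \<omega>)\<^sup>2)"
      using zero_le_power2[of "?S \<omega> - ?R \<omega>"] by (simp add: power2_sum power2_diff)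
    also have "\<dots> \<le> 2 * ((?S \<omega>)\<^sup>2 + 24 * G\<^sup>2 * n)"
      by (intro mult_left_mono add_left_mono R) simp
    finally show "(?E \<omega>)\<^sup>2 \<le> (2 / n\<^sup>2) * ((?S \<omega>)\<^sup>2 + 24 * G\<^sup>2 * n)"
      by (rule rescale)
  qed
  have intS: "integrable M (\<lambda>\<omega>. (?S \<omega>)\<^sup>2)"
  proof (rule integrable_const_bound[of _ "(n * (4 * B / \<beta>))\<^sup>2"])
    show "AE \<omega> in M. norm ((?S \<omega>)\<^sup>2) \<le> (n * (4 * B / \<beta>))\<^sup>2"
    proof (rule AE_I2)
      fix \<omega> assume "\<omega> \<in> space M"
      then have "(\<Sum>j=1..n. \<bar>?D j \<omega>\<bar>) \<le> (\<Sum>j=1..n. 4 * B / \<beta>)"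
        by (intro sum_mono increment_bound)
      then have "\<bar>?S \<omega>\<bar> \<le> n * (4 * B / \<beta>)"
        by (intro order_trans[OF sum_abs]) simp
      then show "norm ((?S \<omega>)\<^sup>2) \<le> (n * (4 * B / \<beta>))\<^sup>2"
        by (metis abs_ge_zero norm_power power2_abs power_mono real_norm_def)
    qed
  qed measurable
  have "(\<integral>\<omega>. \<bar>?E \<omega>\<bar>\<^sup>2 \<partial>M) = (\<integral>\<omega>. (?E \<omega>)\<^sup>2 \<partial>M)"
    by simp
  \<comment> \<open>\<open>integral_mono_AE'\<close> takes integrability and nonnegativity of the
    majorant; a non-integrable left side would have integral 0 by convention.\<close>
  also have "\<dots> \<le> (\<integral>\<omega>. (2 / n\<^sup>2) * ((?S \<omega>)\<^sup>2 + 24 * G\<^sup>2 * n) \<partial>M)"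
    using intS bound by (intro integral_mono_AE') auto
  also have "\<dots> = (2 / n\<^sup>2) * ((\<integral>\<omega>. (?S \<omega>)\<^sup>2 \<partial>M) + 24 * G\<^sup>2 * n)"
    using intS by (simp add: prob_space)
  also have "\<dots> \<le> (2 / n\<^sup>2) * (n * (4 * B / \<beta>)\<^sup>2 + 24 * G\<^sup>2 * n)"
    by (intro mult_left_mono add_right_mono increment_sum_second_moment) auto
  \<comment> \<open>Since \<open>G = 2 * B / \<beta>\<close>, the constant is 224 = 2 * (16 + 24 *
    4).\<close>
  also have "\<dots> = 224 / \<beta>\<^sup>2 * B\<^sup>2 / n"
    using assms \<beta> by (simp add: G_def field_simps power2_eq_square)
  finally show ?thesis .
qed

end

end

section \<open>Mean square error of the AIR algorithm\<close>

theorem proposition3p7: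
  fixes \<X> :: "(real ^ 'd) set"
    and p pt :: "real ^ 'd \<Rightarrow> real"
    and \<U> :: "(real ^ 's) set"
    and z :: "real ^ 's \<Rightarrow> real ^ 'd \<Rightarrow> real ^ 'd"
    and Dinv :: "(real ^ 'd \<Rightarrow> real ^ 'd) \<Rightarrow> real ^ 'd \<Rightarrow> real ^ 'd ^ 'd"
    and MZ :: "(real ^ 'd \<Rightarrow> real ^ 'd) measure"
    and Q0 :: "real ^ 'd \<Rightarrow> (real ^ 'd \<Rightarrow> real ^ 'd) measure"
    and Q :: "nat \<Rightarrow> (nat \<Rightarrow> real ^ 'd) \<times> (nat \<Rightarrow> real ^ 'd \<Rightarrow> real ^ 'd) \<Rightarrow> (real ^ 'd \<Rightarrow> real ^ 'd) measure"
    and M :: "'w measure"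
    and X :: "nat \<Rightarrow> 'w \<Rightarrow> real ^ 'd"
    and Z :: "nat \<Rightarrow> 'w \<Rightarrow> real ^ 'd \<Rightarrow> real ^ 'd"
  assumes "compact \<X>"
    and "\<And>x. x \<in> \<X> \<Longrightarrow> p x > 0" and "continuous_on \<X> p" and "prob_space (density_on \<X> p)"
    and "prob_space (density_on \<X> pt)"
    and "\<And>u. u \<in> \<U> \<Longrightarrow> C1_diffeo_on \<X> (z u) (Dinv (z u))"
    \<comment> \<open>(i)\<close>
    and "\<And>x. x \<in> \<X> \<Longrightarrow> pt x > 0" and "continuous_on \<X> pt"
    \<comment> \<open>(ii)\<close>
    and "continuous_on (\<U> \<times> \<X>) (\<lambda>(u, x). z u x)"
    \<comment> \<open>(iii)\<close>
    and "\<exists>l>0. \<forall>u\<in>\<U>. \<forall>x\<^sub>0\<in>\<X>. \<bar>det (Dinv (z u) x\<^sub>0)\<bar> > l"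
    \<comment> \<open>the set of flows, its sigma-algebra and the algorithm\<close>
    and "space MZ = z ` \<U>"
    and "(\<lambda>(\<zeta>, x). imh_kernel \<X> p pt Dinv \<zeta> x)
           \<in> MZ \<Otimes>\<^sub>M restrict_space borel \<X> \<rightarrow>\<^sub>M prob_algebra (restrict_space borel \<X>)"
    and "\<And>n y. adaptation_time n \<Longrightarrow> (\<And>j. j \<in> {1..n} \<Longrightarrow> y j \<in> \<X>) \<Longrightarrow>
           \<exists>\<zeta>\<in>space MZ. \<forall>\<zeta>'\<in>space MZ.
             flow_objective \<X> pt Dinv n y \<zeta> \<le> flow_objective \<X> pt Dinv n y \<zeta>'"
    and "air_imh_process \<X> p pt Dinv MZ Q0 Q M X Z"
  shows "\<exists>C>0. \<forall>h n. h \<in> borel_measurable (restrict_space borel \<X>) \<longrightarrow> bounded (h ` \<X>) \<longrightarrow> n \<ge> 1 \<longrightarrow>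
           (\<integral>\<omega>. \<bar>(1 / real n) * (\<Sum>j=1..n. h (X j \<omega>)) - (\<integral>x. h x \<partial>density_on \<X> p)\<bar>\<^sup>2 \<partial>M)
             \<le> C * (SUP x\<in>\<X>. \<bar>h x\<bar>)\<^sup>2 / real n"
proof -
  let ?N = "restrict_space borel \<X>"
  obtain l where l: "l > 0" "\<And>u x. u \<in> \<U> \<Longrightarrow> x \<in> \<X> \<Longrightarrow> \<bar>det (Dinv (z u) x)\<bar> > l"
    using assms(10) by blast
  have flow: "imh_flow \<X> p pt Dinv \<zeta> l" if \<zeta>: "\<zeta> \<in> space MZ" for \<zeta>
  proof -
    obtain u where u: "u \<in> \<U>" "\<zeta> = z u"
      using \<zeta> assms(11) by auto
    show ?thesis
      unfolding u(2) by (intro imh_flow.intro assms(1-3,5,7,8) assms(6)[OF u(1)] l(1) l(2)[OF u(1)])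
  qed
  have sets_L: "sets (restrict_space lborel \<X>) = sets ?N"
    by (rule sets_restrict_space_cong) simp
  have spaces: "space ?N = \<X>" "space (density_on \<X> p) = \<X>"
    and sets: "sets (density_on \<X> p) = sets ?N"
    by (simp_all add: density_on_def space_restrict_space sets_L)
  \<comment> \<open>A probability measure lives on a nonempty space; compactness then makes the
    extrema of both densities attained.\<close>
  have "\<X> \<noteq> {}"
    using prob_space.not_empty[OF assms(4)] spaces by simp
  obtain x1 where x1: "x1 \<in> \<X>" "\<And>y. y \<in> \<X> \<Longrightarrow> p y \<le> p x1"
    using continuous_attains_sup[OF assms(1) \<open>\<X> \<noteq> {}\<close> assms(3)] by blast
  obtain x2 where x2: "x2 \<in> \<X>" "\<And>y. y \<in> \<X> \<Longrightarrow> pt x2 \<le> pt y"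
    using continuous_attains_inf[OF assms(1) \<open>\<X> \<noteq> {}\<close> assms(8)] by blast
  \<comment> \<open>The second entry is the minorization constant formed from the minimum of
    \<open>pt\<close>, the Jacobian bound and the maximum of \<open>p\<close>, hence the same for
    all flows. The cap at 1 keeps \<open>1 - \<beta>\<close> nonnegative.\<close>
  define \<beta> where "\<beta> = min 1 (pt x2 * l / p x1)"
  have \<beta>: "0 < \<beta>" "\<beta> \<le> 1"
    using assms(2)[OF x1(1)] assms(7)[OF x2(1)] l by (auto simp: \<beta>_def)
  have proc: "prob_space M" "\<And>n. X n \<in> M \<rightarrow>\<^sub>M ?N" "\<And>n. Z n \<in> M \<rightarrow>\<^sub>M MZ"
    "\<And>n. n \<ge> 1 \<Longrightarrow> \<not> adaptation_time n \<Longrightarrow> AE \<omega> in M. Z n \<omega> = Z (n - 1) \<omega>"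
    "\<And>n. drawn_from M (PiM {..n} (\<lambda>_. ?N) \<Otimes>\<^sub>M PiM {..n} (\<lambda>_. MZ)) ?N
             (\<lambda>\<omega>. (\<lambda>i\<in>{..n}. X i \<omega>, \<lambda>i\<in>{..n}. Z i \<omega>)) (X (Suc n))
             (\<lambda>(xs, zs). imh_kernel \<X> p pt Dinv (zs n) (xs n))"
    using assms(14) unfolding air_imh_process_def Let_def by presburger+
  interpret adaptive_chain M ?N MZ "imh_kernel \<X> p pt Dinv" "density_on \<X> p" \<beta> X Z
  proof (intro adaptive_chain.intro adaptive_chain_axioms.intro proc assms(12) \<beta>)
    show "density_on \<X> p \<in> space (prob_algebra ?N)"
      using assms(4) sets by (simp add: space_prob_algebra)
  next
    fix \<zeta> A assume \<zeta>: "\<zeta> \<in> space MZ" and A: "A \<in> sets ?N"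
    interpret imh_flow \<X> p pt Dinv \<zeta> l by (rule flow[OF \<zeta>])
    show "(\<integral>\<^sup>+x. emeasure (imh_kernel \<X> p pt Dinv \<zeta> x) A \<partial>density_on \<X> p) = emeasure (density_on \<X> p) A"
      using A sets_L by (intro imh_kernel_invariant) simp
    fix x assume "x \<in> space ?N"
    then show "ennreal \<beta> * emeasure (density_on \<X> p) A \<le> emeasure (imh_kernel \<X> p pt Dinv \<zeta> x) A"
      using A sets_L spaces \<beta> x1 x2 assms(2)[OF x1(1)] assms(7)[OF x2(1)]
      by (intro imh_kernel_minorization[where P = "p x1" and m = "pt x2"]) (auto simp: \<beta>_def)
  qed
  show ?thesis
  proof (intro exI[of _ "224 / \<beta>\<^sup>2"] conjI allI impI)
    fix h :: "real ^ 'd \<Rightarrow> real" and n :: nat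
    assume h: "h \<in> borel_measurable ?N" "bounded (h ` \<X>)" "n \<ge> 1"
    \<comment> \<open>Boundedness makes \<open>SUP\<close> a genuine upper bound, which serves as
      \<open>B\<close>; the constant itself involves neither \<open>h\<close> nor
      \<open>n\<close>.\<close>
    have "bdd_above ((\<lambda>x. \<bar>h x\<bar>) ` \<X>)"
      using h(2) by (auto simp: bounded_iff bdd_above_def)
    then have "\<bar>h x\<bar> \<le> (SUP x\<in>\<X>. \<bar>h x\<bar>)" if "x \<in> space ?N" for x
      using that spaces by (intro cSUP_upper) auto
    then show "(\<integral>\<omega>. \<bar>(1 / real n) * (\<Sum>j=1..n. h (X j \<omega>)) - (\<integral>x. h x \<partial>density_on \<X> p)\<bar>\<^sup>2 \<partial>M)
        \<le> 224 / \<beta>\<^sup>2 * (SUP x\<in>\<X>. \<bar>h x\<bar>)\<^sup>2 / real n"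
      by (rule mean_square_error[OF h(1) _ h(3)])
  qed (use \<beta> in simp)
qed

end
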